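(* The following $m$-equivalences hold: $\{121,1243\}\sim\{121,2143\}$, $\{112,1243\}\sim\{112,2143\}$ and $\{121,1234\}\sim\{121,2134\}$.
   Context: A (finite, reduced) multiset is $S=1^{a_1}2^{a_2}\cdots k^{a_k}$ with $k\ge 1$ and all $a_i\ge 1$, meaning that $i$ occurs with multiplicity $a_i$. A multipermutation of $S$ is a word having exactly $a_i$ occurrences of each letter $i\in[k]=\{1,\dots,k\}$ and no other letters. A word $\pi=\pi_1\cdots\pi_n$ contains a pattern (word) $\rho=\rho_1\cdots\rho_\ell$ if there are indices $i(1)<\cdots<i(\ell)$ such that for all $a,b\in[\ell]$: $\pi_{i(a)}<\pi_{i(b)}$ iff $\rho_a<\rho_b$, and $\pi_{i(a)}>\pi_{i(b)}$ iff $\rho_a>\rho_b$; otherwise $\pi$ avoids $\rho$. For a set $P$ of patterns, $\mathrm{av}(S;P)$ is the number of multipermutations of $S$ that avoid every pattern in $P$. Two sets of patterns $P,Q$ are $m$-equivalent, written here $P\sim Q$, if $\mathrm{av}(S;P)=\mathrm{av}(S;Q)$ for every multiset $S$. *)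

theory Defs
  imports "HOL-Combinatorics.Multiset_Permutations"
begin

text \<open>
  A finite reduced multiset $1^{a_1} 2^{a_2} \cdots k^{a_k}$, with $k \ge 1$ and all $a_i \ge 1$,
  is a multiset of naturals whose support is exactly $\{1, \ldots, k\}$; the multiplicity $a_i$ is
  \<open>count S i\<close>. Its multipermutations are the elements of \<open>permutations_of_multiset S\<close>.
\<close>

definition reduced_mset :: "nat multiset \<Rightarrow> bool" where
  "reduced_mset S \<longleftrightarrow> (\<exists>k\<ge>1. set_mset S = {1..k})"

text \<open>Positions in words are counted from 0. The letters of a pattern may repeat, in which case
  the two equivalences force the corresponding letters of the word to be equal.\<close>

definition contains :: "nat list \<Rightarrow> nat list \<Rightarrow> bool" where
  "contains \<pi> \<rho> \<longleftrightarrow>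
    (\<exists>i :: nat \<Rightarrow> nat.
      strict_mono_on {..<length \<rho>} i \<and>
      (\<forall>a<length \<rho>. i a < length \<pi>) \<and>
      (\<forall>a<length \<rho>. \<forall>b<length \<rho>.
        (\<pi> ! i a < \<pi> ! i b \<longleftrightarrow> \<rho> ! a < \<rho> ! b) \<and>
        (\<pi> ! i a > \<pi> ! i b \<longleftrightarrow> \<rho> ! a > \<rho> ! b)))"

abbreviation avoids :: "nat list \<Rightarrow> nat list \<Rightarrow> bool" where
  "avoids \<pi> \<rho> \<equiv> \<not> contains \<pi> \<rho>"

definition av :: "nat multiset \<Rightarrow> nat list set \<Rightarrow> nat" where
  "av S P = card {\<pi> \<in> permutations_of_multiset S. \<forall>\<rho>\<in>P. avoids \<pi> \<rho>}"

definition m_equivalent :: "nat list set \<Rightarrow> nat list set \<Rightarrow> bool" where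
  "m_equivalent P Q \<longleftrightarrow> (\<forall>S. reduced_mset S \<longrightarrow> av S P = av S Q)"

end

theory Submission
  imports Defs "HOL-Library.Sublist"
begin

text \<open>
  Build a word by inserting its letters from the largest to the smallest. In a word avoiding
  \<open>121\<close> the copies of the smallest letter \<open>x\<close> form one block; in a word avoiding \<open>112\<close> all copies of
  \<open>x\<close> but the first stand at the end of the word. In both cases the word is determined by the word
  \<open>w\<close> without \<open>x\<close> and the gap \<open>g\<close> that receives the first \<open>x\<close>, and \<open>g\<close> is arbitrary.

  Let \<open>\<tau>\<close> be \<open>43\<close> or \<open>34\<close> and let \<open>T\<close> be the first gap of \<open>w\<close> with no \<open>\<tau>\<close> to its right. A gap is
  admissible for \<open>12\<tau>\<close> if it has no \<open>1\<tau>\<close> to its right, and for \<open>21\<tau>\<close> if no letter to its left has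
  a \<open>\<tau>\<close> above it to the right of the gap. In both cases every gap from \<open>T\<close> on is admissible and
  insertion there keeps all admissible gaps. If \<open>x\<close> is inserted into an admissible gap \<open>g < T\<close>,
  then, among the admissible gaps left of \<open>T\<close>, those \<open>\<le> g\<close> survive in the case of \<open>21\<tau>\<close> and those
  \<open>\<ge> g\<close> in the case of \<open>12\<tau>\<close>. As \<open>g\<close> varies, both numbers run through \<open>1, \<dots>, m\<close>, where \<open>m\<close> is the
  number of admissible gaps left of \<open>T\<close>. Hence the pair consisting of the number of admissible
  gaps and \<open>T\<close> evolves in the same way for both patterns, and its distributions agree by induction
  on the multiset.
\<close>

section \<open>Containment as subsequences\<close>

lemma subseq_map_nth:
  assumes "strict_mono_on {..<l} i" "\<And>a. a < l \<Longrightarrow> i a < length w"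
  shows "subseq (map (\<lambda>a. w ! i a) [0..<l]) w"
  using assms
proof (induction l arbitrary: w)
  case 0
  then show ?case by simp
next
  case (Suc l)
  have lt: "i a < i l" if "a < l" for a
    using Suc.prems(1) that by (auto simp: strict_mono_on_def)
  have "strict_mono_on {..<l} i"
    using Suc.prems(1) by (auto simp: strict_mono_on_def)
  moreover have "i a < length (take (i l) w)" if "a < l" for a
    using lt[OF that] Suc.prems(2)[of l] by simp
  \<comment> \<open>The word is cut at the last chosen position \<open>i l\<close>: the earlier
    positions fall into the prefix, and the letter at \<open>i l\<close> heads the rest.\<close>
  ultimately have "subseq (map (\<lambda>a. take (i l) w ! i a) [0..<l]) (take (i l) w)"
    by (rule Suc.IH)
  also have "map (\<lambda>a. take (i l) w ! i a) [0..<l] = map (\<lambda>a. w ! i a) [0..<l]"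
    using lt by simp
  finally have "subseq (map (\<lambda>a. w ! i a) [0..<l] @ [w ! i l]) (take (i l) w @ drop (i l) w)"
    using Suc.prems(2)[of l]
    by (intro list_emb_append_mono) (auto simp flip: Cons_nth_drop_Suc)
  then show ?case by simp
qed

lemma subseq_imp_strict_mono:
  assumes "subseq u w"
  shows "\<exists>i::nat \<Rightarrow> nat. strict_mono_on {..<length u} i \<and> (\<forall>a<length u. i a < length w \<and> w ! i a = u ! a)"
  using assms
proof (induction rule: list_emb.induct)
  case (list_emb_Nil ys)
  then show ?case by (auto simp: strict_mono_on_def)
next
  case (list_emb_Cons xs ys y)
  then obtain i where "strict_mono_on {..<length xs} i"
    "\<forall>a<length xs. i a < length ys \<and> ys ! i a = xs ! a" by blast
  then show ?case
    by (intro exI[of _ "Suc \<circ> i"]) (auto simp: strict_mono_on_def)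
next
  case (list_emb_Cons2 x y xs ys)
  then obtain i where i: "strict_mono_on {..<length xs} i"
    "\<forall>a<length xs. i a < length ys \<and> ys ! i a = xs ! a" by blast
  show ?case
    using i \<open>x = y\<close>
    \<comment> \<open>The matched letter in front takes position 0, and all positions found before
      move up by one.\<close>
    by (intro exI[of _ "case_nat 0 (Suc \<circ> i)"])
      (auto simp: strict_mono_on_def less_Suc_eq_0_disj split: nat.splits)
qed

text \<open>Trades position functions for subsequences of letters, so that occurrences can be
  followed through \<open>take\<close>, \<open>drop\<close>, \<open>filter\<close> and
  append.\<close>

lemma contains_iff_subseq:
  "contains w \<rho> \<longleftrightarrow> (\<exists>u. subseq u w \<and> length u = length \<rho> \<and>
     (\<forall>a<length \<rho>. \<forall>b<length \<rho>. (u ! a < u ! b \<longleftrightarrow> \<rho> ! a < \<rho> ! b) \<and> (u ! a > u ! b \<longleftrightarrow> \<rho> ! a > \<rho> ! b)))"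
  (is "_ \<longleftrightarrow> ?R")
proof
  assume "contains w \<rho>"
  then obtain i where i: "strict_mono_on {..<length \<rho>} i" "\<forall>a<length \<rho>. i a < length w"
    "\<forall>a<length \<rho>. \<forall>b<length \<rho>. (w ! i a < w ! i b \<longleftrightarrow> \<rho> ! a < \<rho> ! b) \<and> (w ! i a > w ! i b \<longleftrightarrow> \<rho> ! a > \<rho> ! b)"
    unfolding contains_def by blast
  show ?R
    using subseq_map_nth[OF i(1), of w] i(2,3)
    by (intro exI[of _ "map (\<lambda>a. w ! i a) [0..<length \<rho>]"]) simp
next
  assume ?R
  then obtain u where u: "subseq u w" "length u = length \<rho>"
     "\<forall>a<length \<rho>. \<forall>b<length \<rho>. (u ! a < u ! b \<longleftrightarrow> \<rho> ! a < \<rho> ! b) \<and> (u ! a > u ! b \<longleftrightarrow> \<rho> ! a > \<rho> ! b)"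
    by blast
  then show "contains w \<rho>"
    using subseq_imp_strict_mono[OF u(1)] unfolding contains_def by (metis (no_types, lifting))
qed

section \<open>The six patterns as explicit inequalities between letters\<close>

lemma ex_list_length_3: "(\<exists>u. P u \<and> length u = 3 \<and> Q u) \<longleftrightarrow> (\<exists>a b c. P [a,b,c] \<and> Q [a,b,c])"
  by (auto simp: numeral_eq_Suc length_Suc_conv)

lemma ex_list_length_4: "(\<exists>u. P u \<and> length u = 4 \<and> Q u) \<longleftrightarrow> (\<exists>a b c d. P [a,b,c,d] \<and> Q [a,b,c,d])"
  by (auto simp: numeral_eq_Suc length_Suc_conv)

lemma contains_121: "contains w [1,2,1] \<longleftrightarrow> (\<exists>a b. a < b \<and> subseq [a,b,a] w)"
proof -
  have len: "length [1,2,1::nat] = 3" by simp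
  show ?thesis
    unfolding contains_iff_subseq len ex_list_length_3
    \<comment> \<open>The repeated letter of the pattern enters as two failed strict comparisons,
      which linearity of the order turns into an equality.\<close>
    by (simp add: numeral_3_eq_3 All_less_Suc) (metis linorder_neq_iff order_less_asym)
qed

lemma contains_112: "contains w [1,1,2] \<longleftrightarrow> (\<exists>a b. a < b \<and> subseq [a,a,b] w)"
proof -
  have len: "length [1,1,2::nat] = 3" by simp
  show ?thesis
    unfolding contains_iff_subseq len ex_list_length_3
    by (simp add: numeral_3_eq_3 All_less_Suc) (metis linorder_neq_iff order_less_asym)
qed

text \<open>Both \<open>j < p\<close> and \<open>j < q\<close> are spelled out so that the tails 43
  and 34 fit one shape and differ only in the comparison of \<open>p\<close> with
  \<open>q\<close>.\<close>

lemma contains_1243: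
  "contains w [1,2,4,3] \<longleftrightarrow> (\<exists>i j p q. i < j \<and> j < p \<and> j < q \<and> q < p \<and> subseq [i,j,p,q] w)"
proof -
  have len: "length [1,2,4,3::nat] = 4" by simp
  show ?thesis
    unfolding contains_iff_subseq len ex_list_length_4
    by (simp add: eval_nat_numeral(2,3) All_less_Suc not_less) (meson less_trans less_imp_le)
qed

lemma contains_2143:
  "contains w [2,1,4,3] \<longleftrightarrow> (\<exists>i j p q. i < j \<and> j < p \<and> j < q \<and> q < p \<and> subseq [j,i,p,q] w)"
proof -
  have len: "length [2,1,4,3::nat] = 4" by simp
  show ?thesis
    unfolding contains_iff_subseq len ex_list_length_4
    by (simp add: eval_nat_numeral(2,3) All_less_Suc not_less) (meson less_trans less_imp_le)
qed

lemma contains_1234: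
  "contains w [1,2,3,4] \<longleftrightarrow> (\<exists>i j p q. i < j \<and> j < p \<and> j < q \<and> p < q \<and> subseq [i,j,p,q] w)"
proof -
  have len: "length [1,2,3,4::nat] = 4" by simp
  show ?thesis
    unfolding contains_iff_subseq len ex_list_length_4
    by (simp add: eval_nat_numeral(2,3) All_less_Suc not_less) (meson less_trans less_imp_le)
qed

lemma contains_2134:
  "contains w [2,1,3,4] \<longleftrightarrow> (\<exists>i j p q. i < j \<and> j < p \<and> j < q \<and> p < q \<and> subseq [j,i,p,q] w)"
proof -
  have len: "length [2,1,3,4::nat] = 4" by simp
  show ?thesis
    unfolding contains_iff_subseq len ex_list_length_4
    by (simp add: eval_nat_numeral(2,3) All_less_Suc not_less) (meson less_trans less_imp_le)
qed

section \<open>Inserting copies of a smallest letter\<close>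

text \<open>An embedding of a word free of \<open>x\<close> never touches a copy of
  \<open>x\<close>. Occurrences without \<open>x\<close> in an enlarged word are thereby pulled back
  to the original word.\<close>

lemma subseq_filter_iff:
  assumes "x \<notin> set u"
  shows "subseq u (filter (\<lambda>y. y \<noteq> x) w) \<longleftrightarrow> subseq u w"
proof
  assume "subseq u (filter (\<lambda>y. y \<noteq> x) w)"
  then show "subseq u w" using subseq_filter_left subseq_order.order_trans by blast
next
  assume "subseq u w"
  then have "subseq (filter (\<lambda>y. y \<noteq> x) u) (filter (\<lambda>y. y \<noteq> x) w)" by (rule subseq_filter)
  moreover have "filter (\<lambda>y. y \<noteq> x) u = u" using assms by (auto simp: filter_id_conv)
  ultimately show "subseq u (filter (\<lambda>y. y \<noteq> x) w)" by simp
qed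

lemma subseq_set: "subseq u w \<Longrightarrow> set u \<subseteq> set w"
  by (auto dest: list_emb_set)

lemma subseq_Cons_skip:
  assumes "x \<notin> set p"
  shows "subseq (x # u) (p @ v) \<longleftrightarrow> subseq (x # u) v"
  using assms by (induction p) auto

lemma subseq_dropI: "subseq u (drop k w) \<Longrightarrow> subseq u w"
  using subseq_drop_many[of u "drop k w" "take k w"] by simp

text \<open>One shape serves both classes: \<open>t = a\<close> and \<open>s = 0\<close> for 121,
  \<open>t = 1\<close> and \<open>s = a - 1\<close> for 112, where \<open>a\<close> is the
  multiplicity of \<open>x\<close>.\<close>

definition insert_copies :: "'a \<Rightarrow> nat \<Rightarrow> nat \<Rightarrow> nat \<Rightarrow> 'a list \<Rightarrow> 'a list" where
  "insert_copies x t s g w = take g w @ replicate t x @ drop g w @ replicate s x"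

text \<open>Gap \<open>h\<close> of \<open>insert_copies x t s g w\<close> lies over gap \<open>old_pos t g h\<close> of \<open>w\<close>, up to
  truncation: the copies at the end are not subtracted, which is harmless in
  \<open>take\<close> and \<open>drop\<close>.\<close>

definition old_pos :: "nat \<Rightarrow> nat \<Rightarrow> nat \<Rightarrow> nat" where
  "old_pos t g h = (if h \<le> g then h else max g (h - t))"

lemma length_insert_copies [simp]: "length (insert_copies x t s g w) = length w + t + s"
  by (auto simp: insert_copies_def min_def)

lemma drop_insert_copies_le:
  "h \<le> g \<Longrightarrow> g \<le> length w \<Longrightarrow> drop h (insert_copies x t s g w)
    = drop h (take g w) @ replicate t x @ drop g w @ replicate s x"
  by (simp add: insert_copies_def)

lemma drop_insert_copies_mid:
  "g \<le> h \<Longrightarrow> h \<le> g + t \<Longrightarrow> g \<le> length w \<Longrightarrow> drop h (insert_copies x t s g w)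
    = replicate (t - (h - g)) x @ drop g w @ replicate s x"
  by (simp add: insert_copies_def min_def)

text \<open>Behind the block, the copies at the end are consumed only after all of \<open>w\<close>;
  the inner truncated difference counts how many are gone.\<close>

lemma drop_insert_copies_ge:
  "g + t \<le> h \<Longrightarrow> g \<le> length w \<Longrightarrow> drop h (insert_copies x t s g w)
    = drop (h - t) w @ replicate (s - (h - t - length w)) x"
  by (auto simp: insert_copies_def min_def algebra_simps)

context
  fixes x :: nat and w :: "nat list"
  assumes min: "\<And>y. y \<in> set w \<Longrightarrow> x < y"
begin

lemma x_notin: "x \<notin> set w" "x \<notin> set (take k w)" "x \<notin> set (drop k w)"
  using min by (blast dest: in_set_takeD in_set_dropD)+

lemma filter_neq_id: "filter (\<lambda>y. y \<noteq> x) (take k w) = take k w" "filter (\<lambda>y. y \<noteq> x) (drop k w)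
  = drop k w" "filter (\<lambda>y. y \<noteq> x) w = w"
  "filter (\<lambda>y. y \<noteq> x) (take k (drop l w)) = take k (drop l w)" 
  using min by (auto simp: filter_id_conv dest: in_set_takeD in_set_dropD)

lemma filter_insert_copies: "filter (\<lambda>y. y \<noteq> x) (insert_copies x t s g w) = w"
  by (simp add: insert_copies_def filter_neq_id)

lemma filter_drop_insert_copies:
  assumes "g \<le> length w"
  shows "filter (\<lambda>y. y \<noteq> x) (drop h (insert_copies x t s g w)) = drop (old_pos t g h) w"
proof -
  consider "h \<le> g" | "g < h" "h \<le> g + t" | "g + t < h" by linarith
  then show ?thesis
  proof cases
    case 1
    have "drop h (take g w) @ drop g w = drop h w"
      using 1 assms by (metis append_take_drop_id drop_append diff_is_0_eq drop_0 length_take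
        min.absorb2)
    then show ?thesis using 1 assms
      by (simp add: drop_insert_copies_le old_pos_def filter_neq_id drop_take)
  next
    case 2
    then have "old_pos t g h = g" by (auto simp: old_pos_def)
    then show ?thesis using 2 assms
      by (simp add: drop_insert_copies_mid filter_neq_id)
  next
    case 3
    then have "old_pos t g h = h - t" by (auto simp: old_pos_def)
    then show ?thesis using 3 assms
      by (simp add: drop_insert_copies_ge filter_neq_id)
  qed
qed

lemma set_take_insert_copies:
  assumes "g \<le> length w" "t \<ge> 1"
  shows "set (take h (insert_copies x t s g w))
    = (if h \<le> g then {} else {x}) \<union> set (take (old_pos t g h) w)"
proof -
  consider "h \<le> g" | "g < h" "h \<le> g + t" | "g + t < h" by linarith
  then show ?thesis
  proof cases
    case 1
    then show ?thesis using assms by (simp add: insert_copies_def old_pos_def min_def)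
  next
    case 2
    then have "old_pos t g h = g" by (auto simp: old_pos_def)
    then show ?thesis using 2 assms by (auto simp: insert_copies_def min_def)
  next
    case 3
    then have "old_pos t g h = h - t" by (auto simp: old_pos_def)
    moreover have "set (take g w) \<union> set (take (h - t - g) (drop g w)) = set (take (h - t) w)"
      using 3 by (metis set_append take_add le_add_diff_inverse add_leD1 less_imp_le le_diff_conv2
        add.commute)
    ultimately show ?thesis using 3 assms
      by (auto simp: insert_copies_def min_def algebra_simps)
  qed
qed

lemma subseq_drop_insert_copies:
  assumes "g \<le> length w" "x \<notin> set u"
  shows "subseq u (drop h (insert_copies x t s g w)) \<longleftrightarrow> subseq u (drop (old_pos t g h) w)"
  using subseq_filter_iff[OF assms(2)] filter_drop_insert_copies[OF assms(1)] by metis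

lemma subseq_insert_copies:
  assumes "x \<notin> set u"
  shows "subseq u (insert_copies x t s g w) \<longleftrightarrow> subseq u w"
  using subseq_filter_iff[OF assms] filter_insert_copies by metis

text \<open>A copy of \<open>x\<close> at the end has only copies of \<open>x\<close> behind it, so
  with \<open>u\<close> nonempty and free of \<open>x\<close> the leading \<open>x\<close> must come
  from the block. Some copy of the block is left in the suffix exactly when
  \<open>h < g + t\<close>.\<close>

lemma subseq_Cons_drop_insert_copies:
  assumes "g \<le> length w" "t \<ge> 1" "x \<notin> set u" "u \<noteq> []"
  shows "subseq (x # u) (drop h (insert_copies x t s g w)) \<longleftrightarrow> h < g + t \<and> subseq u (drop g w)"
proof (cases "h < g + t")
  case False
  \<comment> \<open>Behind the block only a suffix of \<open>w\<close> and copies of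
    \<open>x\<close> remain, and \<open>x # u\<close> would have to fit into these copies.\<close>
  have "\<not> subseq (x # u) (drop (h - t) w @ replicate k x)" for k
  proof
    assume "subseq (x # u) (drop (h - t) w @ replicate k x)"
    then have "subseq (x # u) (replicate k x)" using subseq_Cons_skip x_notin by metis
    then have "set u \<subseteq> {x}" using subseq_set by fastforce
    with assms show False by (cases u) auto
  qed
  then show ?thesis using False assms by (simp add: drop_insert_copies_ge)
next
  case True
  \<comment> \<open>The suffix is cut at the first block copy it still contains; this is the best
    match for the leading \<open>x\<close>.\<close>
  obtain p k where "drop h (insert_copies x t s g w)
    = p @ x # replicate k x @ drop g w @ replicate s x" "x \<notin> set p"
  proof (cases "h \<le> g")
    case True
    have "drop h (insert_copies x t s g w)
      = drop h (take g w) @ x # replicate (t - 1) x @ drop g w @ replicate s x"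
      using True assms by (cases t) (auto simp: drop_insert_copies_le)
    then show ?thesis using that x_notin by (metis in_set_dropD)
  next
    case False
    have "replicate (t - (h - g)) x = x # replicate (t - (h - g) - 1) x"
      using False True by (cases "t - (h - g)") auto
    then have "drop h (insert_copies x t s g w)
      = [] @ x # replicate (t - (h - g) - 1) x @ drop g w @ replicate s x"
      using False True assms by (simp add: drop_insert_copies_mid)
    then show ?thesis using that[of "[]"] by simp
  qed
  then have "subseq (x # u) (drop h (insert_copies x t s g w)) \<longleftrightarrow>
    subseq u (replicate k x @ drop g w @ replicate s x)"
    using subseq_Cons_skip by (metis subseq_Cons2_iff)
  also have "\<dots> \<longleftrightarrow> subseq u (filter (\<lambda>y. y \<noteq> x) (replicate k x @ drop g w @ replicate s x))"
    using subseq_filter_iff[OF assms(3)] by metis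
  also have "\<dots> \<longleftrightarrow> subseq u (drop g w)" by (simp add: filter_neq_id)
  finally show ?thesis using True by simp
qed

end

section \<open>Admissible gaps\<close>

text \<open>The tail of the two long patterns is \<open>43\<close> for \<open>R = (>)\<close> and \<open>34\<close> for \<open>R = (<)\<close>.\<close>

definition tau :: "(nat \<Rightarrow> nat \<Rightarrow> bool) \<Rightarrow> nat list \<Rightarrow> bool" where
  "tau R v \<longleftrightarrow> (\<exists>p q. R p q \<and> subseq [p,q] v)"

definition tau_above :: "(nat \<Rightarrow> nat \<Rightarrow> bool) \<Rightarrow> nat \<Rightarrow> nat list \<Rightarrow> bool" where
  "tau_above R j v \<longleftrightarrow> (\<exists>p q. j < p \<and> j < q \<and> R p q \<and> subseq [p,q] v)"

definition one_tau :: "(nat \<Rightarrow> nat \<Rightarrow> bool) \<Rightarrow> nat list \<Rightarrow> bool" where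
  "one_tau R v \<longleftrightarrow> (\<exists>j p q. j < p \<and> j < q \<and> R p q \<and> subseq [j,p,q] v)"

definition contains_12_tau :: "(nat \<Rightarrow> nat \<Rightarrow> bool) \<Rightarrow> nat list \<Rightarrow> bool" where
  "contains_12_tau R w \<longleftrightarrow> (\<exists>i j p q. i < j \<and> j < p \<and> j < q \<and> R p q \<and> subseq [i,j,p,q] w)"

definition contains_21_tau :: "(nat \<Rightarrow> nat \<Rightarrow> bool) \<Rightarrow> nat list \<Rightarrow> bool" where
  "contains_21_tau R w \<longleftrightarrow> (\<exists>i j p q. i < j \<and> j < p \<and> j < q \<and> R p q \<and> subseq [j,i,p,q] w)"

text \<open>This is the gap T of the overview. The minimum exists because the empty suffix contains
  no tail.\<close>

definition tau_end :: "(nat \<Rightarrow> nat \<Rightarrow> bool) \<Rightarrow> nat list \<Rightarrow> nat" where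
  "tau_end R w = (LEAST h. \<not> tau R (drop h w))"

text \<open>For the pattern that starts with 12 the admissible gaps form an interval starting here.
  For 21 they need not: with \<open>R = (>)\<close> and the word \<open>[2,4,3,1,0]\<close>, gaps 0,
  2 and 3 are admissible but gap 1 is not, although all lie left of \<open>tau_end\<close>.\<close>

definition one_tau_end :: "(nat \<Rightarrow> nat \<Rightarrow> bool) \<Rightarrow> nat list \<Rightarrow> nat" where
  "one_tau_end R w = (LEAST h. \<not> one_tau R (drop h w))"

text \<open>The gaps into which a new smallest letter can be put without creating \<open>12\<tau>\<close>, respectively \<open>21\<tau>\<close>,
  where \<open>\<tau>\<close> is the tail.\<close>

definition gaps12 :: "(nat \<Rightarrow> nat \<Rightarrow> bool) \<Rightarrow> nat list \<Rightarrow> nat set" where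
  "gaps12 R w = {h. h \<le> length w \<and> \<not> one_tau R (drop h w)}"

definition gaps21 :: "(nat \<Rightarrow> nat \<Rightarrow> bool) \<Rightarrow> nat list \<Rightarrow> nat set" where
  "gaps21 R w = {h. h \<le> length w \<and> \<not> (\<exists>j\<in>set (take h w). tau_above R j (drop h w))}"

text \<open>A property that passes from a suffix to the whole word can only be lost as the suffix
  shrinks, so it holds exactly below a threshold.\<close>

lemma least_drop:
  fixes w :: "'a list" and P :: "'a list \<Rightarrow> bool"
  defines "m \<equiv> LEAST h. \<not> P (drop h w)"
  assumes suffix: "\<And>v k. P (drop k v) \<Longrightarrow> P v" and Nil: "\<not> P []"
  shows "P (drop h w) \<longleftrightarrow> h < m" and "m \<le> length w"
proof -
  have ex: "\<not> P (drop (length w) w)" using Nil by simp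
  show "m \<le> length w" unfolding m_def using ex by (rule Least_le)
  have least: "\<not> P (drop m w)" unfolding m_def using ex by (rule LeastI)
  have "\<not> P (drop h w)" if "m \<le> h"
  proof
    assume "P (drop h w)"
    then have "P (drop (h - m) (drop m w))" using that by simp
    then show False using suffix least by metis
  qed
  moreover have "P (drop h w)" if "h < m"
    using not_less_Least[of h "\<lambda>h. \<not> P (drop h w)"] that unfolding m_def by simp
  ultimately show "P (drop h w) \<longleftrightarrow> h < m" by (meson not_less)
qed

lemma tau_drop: "tau R (drop k v) \<Longrightarrow> tau R v"
  unfolding tau_def by (blast intro: subseq_dropI)

lemma one_tau_drop: "one_tau R (drop k v) \<Longrightarrow> one_tau R v"
  unfolding one_tau_def by (blast intro: subseq_dropI)

lemma tau_drop_iff: "tau R (drop h w) \<longleftrightarrow> h < tau_end R w"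
  unfolding tau_end_def by (rule least_drop(1)[OF tau_drop]) (simp_all add: tau_def)

lemma tau_end_le: "tau_end R w \<le> length w"
  unfolding tau_end_def by (rule least_drop(2)[OF tau_drop]) (simp_all add: tau_def)

lemma one_tau_drop_iff: "one_tau R (drop h w) \<longleftrightarrow> h < one_tau_end R w"
  unfolding one_tau_end_def by (rule least_drop(1)[OF one_tau_drop]) (simp_all add: one_tau_def)

lemma one_tau_end_le: "one_tau_end R w \<le> length w"
  unfolding one_tau_end_def by (rule least_drop(2)[OF one_tau_drop]) (simp_all add: one_tau_def)

lemma tau_endI:
  assumes "\<not> tau R (drop k w)" "k = 0 \<or> tau R (drop (k - 1) w)"
  shows "tau_end R w = k"
  using assms unfolding tau_drop_iff by linarith

lemma one_tau_imp_tau: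
  assumes "one_tau R v"
  shows "tau R v"
proof -
  from assms obtain j p q where "R p q" "subseq [j,p,q] v" unfolding one_tau_def by auto
  then show ?thesis unfolding tau_def using subseq_Cons'[of j "[p,q]" v] by auto
qed

lemma one_tau_end_le_tau_end: "one_tau_end R w \<le> tau_end R w"
proof -
  have "\<not> one_tau R (drop (tau_end R w) w)"
    using one_tau_imp_tau tau_drop_iff less_irrefl by metis
  then show ?thesis unfolding one_tau_drop_iff by simp
qed

lemma gaps12_eq: "gaps12 R w = {one_tau_end R w..length w}"
  by (auto simp: gaps12_def one_tau_drop_iff)

lemma tau_above_imp_tau: "tau_above R j v \<Longrightarrow> tau R v"
  unfolding tau_above_def tau_def by blast

text \<open>From \<open>tau_end\<close> on, no tail is left to the right of the gap, so nothing can
  forbid it.\<close>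

lemma gaps21_eq: "gaps21 R w = (gaps21 R w \<inter> {..<tau_end R w}) \<union> {tau_end R w..length w}"
proof -
  have "h < tau_end R w" if "tau_above R j (drop h w)" for j h
    using tau_above_imp_tau[OF that] by (simp add: tau_drop_iff)
  then show ?thesis by (fastforce simp: gaps21_def not_less)
qed

lemma card_gaps21:
  "card (gaps21 R w) = card (gaps21 R w \<inter> {..<tau_end R w}) + (length w + 1 - tau_end R w)"
proof -
  have "card (gaps21 R w) = card ((gaps21 R w \<inter> {..<tau_end R w}) \<union> {tau_end R w..length w})"
    using gaps21_eq by metis
  also have "\<dots> = card (gaps21 R w \<inter> {..<tau_end R w}) + card {tau_end R w..length w}"
    by (rule card_Un_disjoint) auto
  finally show ?thesis by simp
qed

section \<open>The effect of one insertion on occurrences and on admissible gaps\<close>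

context
  fixes x :: nat and w :: "nat list" and g t s :: nat and R :: "nat \<Rightarrow> nat \<Rightarrow> bool"
  assumes min: "\<And>y. y \<in> set w \<Longrightarrow> x < y" and g: "g \<le> length w" and t: "t \<ge> 1"
begin

lemma le_insert_copies: "y \<in> set (drop h (insert_copies x t s g w)) \<Longrightarrow> x \<le> y"
  using min by (auto simp: insert_copies_def dest!: in_set_dropD in_set_takeD intro: less_imp_le)

text \<open>Letters above \<open>j\<close> exceed \<open>x\<close>, so inserted copies take no part
  in such a tail.\<close>

lemma tau_above_old:
  assumes "x \<le> j"
  shows "tau_above R j (drop h (insert_copies x t s g w)) \<longleftrightarrow> tau_above R j (drop (old_pos t g h) w)"
proof -
  have "j < p \<and> j < q \<Longrightarrow> subseq [p,q] (drop h (insert_copies x t s g w)) \<longleftrightarrow>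
    subseq [p,q] (drop (old_pos t g h) w)" for p q
    using assms by (intro subseq_drop_insert_copies min g) auto
  then show ?thesis unfolding tau_above_def by metis
qed

lemma tau_above_min: "tau_above R x (drop h w) \<longleftrightarrow> tau R (drop h w)"
proof -
  have "subseq [p,q] (drop h w) \<Longrightarrow> x < p \<and> x < q" for p q
    using min subseq_set[of "[p,q]" "drop h w"] by (auto dest!: in_set_dropD)
  then show ?thesis unfolding tau_above_def tau_def by blast
qed

text \<open>Being smallest, \<open>x\<close> can only play the 1. It then needs a block copy right
  of gap \<open>h\<close> and a tail of \<open>w\<close> behind gap \<open>g\<close>; every tail of
  \<open>w\<close> lies above \<open>x\<close>.\<close>

lemma one_tau_insert:
  "one_tau R (drop h (insert_copies x t s g w)) \<longleftrightarrow>
    one_tau R (drop (old_pos t g h) w) \<or> (h < g + t \<and> tau R (drop g w))"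
proof -
  have 1: "subseq [j,p,q] (drop h (insert_copies x t s g w)) \<longleftrightarrow> subseq [j,p,q] (drop (old_pos t g h) w)"
    if "x < j" "j < p" "j < q" for j p q
    using that by (intro subseq_drop_insert_copies min g) auto
  have 2: "subseq [x,p,q] (drop h (insert_copies x t s g w)) \<longleftrightarrow> h < g + t \<and> subseq [p,q] (drop g w)"
    if "x < p" "x < q" for p q
    using that by (intro subseq_Cons_drop_insert_copies min g t) auto
  have 3: "x \<le> j" if "subseq [j,p,q] (drop h (insert_copies x t s g w))" for j p q
    using le_insert_copies[of j h] subseq_set[OF that] by simp
  have 4: "x < j" if "subseq [j,p,q] (drop h w)" for j p q h
    using subseq_set[OF that] min by (auto dest!: in_set_dropD)
  show ?thesis (is "?l \<longleftrightarrow> ?r")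
  proof
    assume ?l
    then obtain j p q where j: "j < p" "j < q" "R p q" "subseq [j,p,q] (drop h
      (insert_copies x t s g w))"
      unfolding one_tau_def by blast
    show ?r
    proof (cases "j = x")
      case True
      then show ?thesis using 2[of p q] j unfolding tau_def by auto
    next
      case False
      then have "x < j" using 3[OF j(4)] by simp
      then show ?thesis using 1[of j p q] j unfolding one_tau_def by auto
    qed
  next
    assume ?r
    then show ?l
    proof
      assume "one_tau R (drop (old_pos t g h) w)"
      then obtain j p q where j: "j < p" "j < q" "R p q" "subseq [j,p,q] (drop (old_pos t g h) w)"
        unfolding one_tau_def by blast
      then have "subseq [j,p,q] (drop h (insert_copies x t s g w))" using 1[of j p q] 4[OF j(4)] by simp
      with j show ?l unfolding one_tau_def by blast
    next
      assume "h < g + t \<and> tau R (drop g w)"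
      then have h: "h < g + t" and "tau_above R x (drop g w)" by (simp_all add: tau_above_min)
      then obtain p q where p: "x < p" "x < q" "R p q" "subseq [p,q] (drop g w)"
        unfolding tau_above_def by blast
      then have "subseq [x,p,q] (drop h (insert_copies x t s g w))" using 2[of p q] h by simp
      with p show ?l unfolding one_tau_def by blast
    qed
  qed
qed

lemma contains_12_tau_insert: "contains_12_tau R (insert_copies x t s g w) \<longleftrightarrow>
  contains_12_tau R w \<or> one_tau R (drop g w)"
proof -
  have 1: "subseq [i,j,p,q] (insert_copies x t s g w) \<longleftrightarrow> subseq [i,j,p,q] w"
    if "x < i" "i < j" "j < p" "j < q" for i j p q
    using that by (intro subseq_insert_copies min) auto
  have 2: "subseq [x,j,p,q] (insert_copies x t s g w) \<longleftrightarrow> subseq [j,p,q] (drop g w)"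
    if "x < j" "j < p" "j < q" for j p q
    using that subseq_Cons_drop_insert_copies[OF min g t, of "[j,p,q]" 0 s] t by auto
  have 3: "x \<le> i" if "subseq [i,j,p,q] (insert_copies x t s g w)" for i j p q
    using le_insert_copies[of i 0] subseq_set[OF that] by simp
  have 4: "x < i" if "subseq (i # u) w" for i u
    using subseq_set[OF that] min by auto
  show ?thesis (is "?l \<longleftrightarrow> ?r")
  proof
    assume ?l
    then obtain i j p q where i: "i < j" "j < p" "j < q" "R p q" "subseq [i,j,p,q]
      (insert_copies x t s g w)"
      unfolding contains_12_tau_def by blast
    show ?r
    proof (cases "i = x")
      case True
      then show ?thesis using 2[of j p q] i unfolding one_tau_def by auto
    next
      case False
      then have "x < i" using 3[OF i(5)] by simp
      then show ?thesis using 1[of i j p q] i unfolding contains_12_tau_def by auto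
    qed
  next
    assume ?r
    then show ?l
    proof
      assume "contains_12_tau R w"
      then obtain i j p q where i: "i < j" "j < p" "j < q" "R p q" "subseq [i,j,p,q] w"
        unfolding contains_12_tau_def by blast
      then have "subseq [i,j,p,q] (insert_copies x t s g w)" using 1[of i j p q] 4[OF i(5)] by simp
      with i show ?l unfolding contains_12_tau_def by blast
    next
      assume "one_tau R (drop g w)"
      then obtain j p q where j: "j < p" "j < q" "R p q" "subseq [j,p,q] (drop g w)"
        unfolding one_tau_def by blast
      have "x < j" using 4 subseq_dropI[OF j(4)] .
      moreover from this have "subseq [x,j,p,q] (insert_copies x t s g w)" using 2[of j p q] j by simp
      ultimately show ?l using j unfolding contains_12_tau_def by blast
    qed
  qed
qed

text \<open>Again \<open>x\<close> can only play the 1, now with a letter \<open>j\<close> in front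
  of the block and a tail above \<open>j\<close> behind it.\<close>

lemma contains_21_tau_insert:
  "contains_21_tau R (insert_copies x t s g w) \<longleftrightarrow>
    contains_21_tau R w \<or> (\<exists>j\<in>set (take g w). tau_above R j (drop g w))"
proof -
  have 1: "subseq [j,i,p,q] (insert_copies x t s g w) \<longleftrightarrow> subseq [j,i,p,q] w"
    if "x < i" "i < j" "j < p" "j < q" for i j p q
    using that by (intro subseq_insert_copies min) auto
  have 2: "subseq [j,x,p,q] (insert_copies x t s g w) \<longleftrightarrow>
    j \<in> set (take g w) \<and> subseq [p,q] (drop g w)" (is "?l \<longleftrightarrow> ?r")
    if "x < j" "j < p" "j < q" for j p q
  proof
    assume ?l
    then have "subseq ([j] @ [x,p,q]) (insert_copies x t s g w)" by simp
    then obtain W1 W2 where W: "insert_copies x t s g w = W1 @ W2" "subseq [j] W1" "subseq [x,p,q] W2"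
      by (blast dest: list_emb_appendD)
    \<comment> \<open>The new word is split between \<open>j\<close> and the matched
      \<open>x\<close>; \<open>h\<close> is the gap of this split.\<close>
    define h where "h = length W1"
    have h: "W1 = take h (insert_copies x t s g w)" "W2 = drop h (insert_copies x t s g w)"
      using W(1) by (auto simp: h_def)
    have "subseq (x # [p,q]) (drop h (insert_copies x t s g w)) \<longleftrightarrow> h < g + t \<and> subseq [p,q] (drop g w)"
      using that by (intro subseq_Cons_drop_insert_copies min g t) auto
    then have hg: "h < g + t" "subseq [p,q] (drop g w)" using W(3) unfolding h(2) by simp_all
    have "j \<in> set (take (old_pos t g h) w)"
    proof -
      have "j \<in> set (take h (insert_copies x t s g w))" using W(2) unfolding h(1) subseq_singleton_left .
      moreover have "set (take h (insert_copies x t s g w))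
        = (if h \<le> g then {} else {x}) \<union> set (take (old_pos t g h) w)"
        by (rule set_take_insert_copies) (use min g t in auto)
      ultimately show ?thesis using that by (simp split: if_splits)
    qed
    \<comment> \<open>Since a block copy still lies right of \<open>h\<close>, the letters of
      \<open>w\<close> left of \<open>h\<close> all stand before gap \<open>g\<close>.\<close>
    moreover have "old_pos t g h \<le> g" using hg by (auto simp: old_pos_def)
    ultimately show ?r using hg(2) set_take_subset_set_take[of "old_pos t g h" g w] by auto
  next
    assume r: ?r
    have "subseq ([j] @ [x] @ [p,q] @ []) (take g w @ replicate t x @ drop g w @ replicate s x)"
      using r t by (intro list_emb_append_mono) (auto simp: subseq_singleton_left)
    then show ?l by (simp add: insert_copies_def)
  qed
  have 3: "x \<le> i" if "subseq [j,i,p,q] (insert_copies x t s g w)" for i j p q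
    using le_insert_copies[of i 0] subseq_set[OF that] by simp
  have 4: "x < i" if "subseq [j,i,p,q] w" for i j p q
    using subseq_set[OF that] min by auto
  show ?thesis (is "?l \<longleftrightarrow> ?r")
  proof
    assume ?l
    then obtain i j p q where i: "i < j" "j < p" "j < q" "R p q" "subseq [j,i,p,q]
      (insert_copies x t s g w)"
      unfolding contains_21_tau_def by blast
    show ?r
    proof (cases "i = x")
      case True
      then show ?thesis using 2[of j p q] i unfolding tau_above_def by auto
    next
      case False
      then have "x < i" using 3[OF i(5)] by simp
      then show ?thesis using 1[of i j p q] i unfolding contains_21_tau_def by auto
    qed
  next
    assume ?r
    then show ?l
    proof
      assume "contains_21_tau R w"
      then obtain i j p q where i: "i < j" "j < p" "j < q" "R p q" "subseq [j,i,p,q] w"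
        unfolding contains_21_tau_def by blast
      then have "subseq [j,i,p,q] (insert_copies x t s g w)" using 1[of i j p q] 4[OF i(5)] by simp
      with i show ?l unfolding contains_21_tau_def by blast
    next
      assume "\<exists>j\<in>set (take g w). tau_above R j (drop g w)"
      then obtain j p q where j: "j \<in> set (take g w)" "j < p" "j < q" "R p q" "subseq [p,q] (drop g w)"
        unfolding tau_above_def by blast
      then have "x < j" using min by (auto dest: in_set_takeD)
      moreover from this have "subseq [j,x,p,q] (insert_copies x t s g w)" using 2[of j p q] j by simp
      ultimately show ?l using j unfolding contains_21_tau_def by blast
    qed
  qed
qed

text \<open>If a tail lies right of \<open>g\<close>, the block turns it into a forbidden 1 with
  tail for every gap before the end of the block, so exactly the gaps from \<open>g + t\<close> on
  remain. Otherwise the left end of the interval stays and the length grows by \<open>t + s\<close>.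
  The first count is split at \<open>tau_end\<close> to match \<open>gaps21_insert\<close>.\<close>

lemma gaps12_insert:
  assumes "g \<in> gaps12 R w"
  shows "card (gaps12 R (insert_copies x t s g w)) = (if g < tau_end R w
    then length w + s + 1 - tau_end R w + card (gaps12 R w \<inter> {g..<tau_end R w})
    else card (gaps12 R w) + t + s)"
proof -
  have L: "one_tau_end R w \<le> g" using assms by (simp add: gaps12_eq)
  have iff: "one_tau R (drop h (insert_copies x t s g w)) \<longleftrightarrow>
    old_pos t g h < one_tau_end R w \<or> (h < g + t \<and> g < tau_end R w)" for h
    unfolding one_tau_insert by (simp add: one_tau_drop_iff tau_drop_iff)
  show ?thesis
  proof (cases "g < tau_end R w")
    case True
    have "gaps12 R (insert_copies x t s g w) = {g + t..length w + t + s}"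
      unfolding gaps12_def iff using True L by (auto simp: old_pos_def)
    moreover have "gaps12 R w \<inter> {g..<tau_end R w} = {g..<tau_end R w}"
      using L tau_end_le[of R w] by (auto simp: gaps12_eq)
    ultimately show ?thesis using True tau_end_le[of R w] by simp
  next
    case False
    have "gaps12 R (insert_copies x t s g w) = {one_tau_end R w..length w + t + s}"
      unfolding gaps12_def iff using False L by (auto simp: old_pos_def)
    then show ?thesis using False one_tau_end_le[of R w] by (simp add: gaps12_eq)
  qed
qed

text \<open>Gaps up to \<open>g\<close> see the same letters to the left and the same relevant tails
  to the right. A gap beyond \<open>g\<close> has \<open>x\<close> on its left, so it is admissible
  exactly when no tail remains on its right.\<close>

lemma gaps21_insert:
  assumes "g \<in> gaps21 R w"
  shows "card (gaps21 R (insert_copies x t s g w)) = (if g < tau_end R w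
    then length w + s + 1 - tau_end R w + card (gaps21 R w \<inter> {..g})
    else card (gaps21 R w) + t + s)"
proof -
  have iff: "(\<exists>j\<in>set (take h (insert_copies x t s g w)). tau_above R j (drop h
    (insert_copies x t s g w))) \<longleftrightarrow>
    (if h \<le> g then (\<exists>j\<in>set (take h w). tau_above R j (drop h w)) else old_pos t g h < tau_end R w)" for h
  proof -
    have le: "x \<le> j" if "j \<in> set (take k w)" for j k
      using that min by (auto dest!: in_set_takeD intro: less_imp_le)
    have *: "(\<exists>j\<in>set (take k w). tau_above R j (drop h (insert_copies x t s g w))) \<longleftrightarrow>
      (\<exists>j\<in>set (take k w). tau_above R j (drop (old_pos t g h) w))" for k
      using le tau_above_old by blast
    have x: "tau_above R x (drop h (insert_copies x t s g w)) \<longleftrightarrow> old_pos t g h < tau_end R w"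
      unfolding tau_above_old[OF order_refl] tau_above_min by (rule tau_drop_iff)
    have set: "set (take h (insert_copies x t s g w))
      = (if h \<le> g then {} else {x}) \<union> set (take (old_pos t g h) w)"
      by (rule set_take_insert_copies) (use min g t in auto)
    show ?thesis
    proof (cases "h \<le> g")
      case True
      then show ?thesis using *[of h] by (simp add: set old_pos_def)
    next
      case False
      have "old_pos t g h < tau_end R w" if "tau_above R j (drop (old_pos t g h) w)" for j
        using tau_above_imp_tau[OF that] unfolding tau_drop_iff .
      then show ?thesis using False x *[of "old_pos t g h"] by (auto simp: set)
    qed
  qed
  have G: "gaps21 R (insert_copies x t s g w) = (gaps21 R w \<inter> {..g}) \<union> {h. g < h \<and>
    h \<le> length w + t + s \<and> tau_end R w \<le> old_pos t g h}"
    using g unfolding gaps21_def iff by auto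
  show ?thesis
  proof (cases "g < tau_end R w")
    case True
    \<comment> \<open>As \<open>tau_end\<close> exceeds \<open>g\<close>, the condition on
      \<open>old_pos\<close> fails throughout the block and starts to hold at
      \<open>tau_end R w + t\<close>.\<close>
    have "{h. g < h \<and> h \<le> length w + t + s \<and>
      tau_end R w \<le> old_pos t g h} = {tau_end R w + t..length w + t + s}"
      using True t by (auto simp: old_pos_def)
    then have "gaps21 R (insert_copies x t s g w)
      = (gaps21 R w \<inter> {..g}) \<union> {tau_end R w + t..length w + t + s}"
      using G by simp
    also have "card \<dots> = card (gaps21 R w \<inter> {..g}) + card {tau_end R w + t..length w + t + s}"
      using True by (intro card_Un_disjoint) auto
    finally have "card (gaps21 R (insert_copies x t s g w))
      = card (gaps21 R w \<inter> {..g}) + card {tau_end R w + t..length w + t + s}" .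
    then show ?thesis using True tau_end_le[of R w] by simp
  next
    case False
    \<comment> \<open>Beyond \<open>g\<close> the value of \<open>old_pos\<close> is at least
      \<open>g\<close>, hence at least \<open>tau_end\<close>, and the condition always
      holds.\<close>
    have "{h. g < h \<and> h \<le> length w + t + s \<and> tau_end R w \<le> old_pos t g h} = {g<..length w + t + s}"
      using False by (auto simp: old_pos_def)
    then have "gaps21 R (insert_copies x t s g w) = (gaps21 R w \<inter> {..g}) \<union> {g<..length w + t + s}"
      using G by simp
    also have "card \<dots> = card (gaps21 R w \<inter> {..g}) + card {g<..length w + t + s}"
      by (intro card_Un_disjoint) auto
    finally have 1: "card (gaps21 R (insert_copies x t s g w))
      = card (gaps21 R w \<inter> {..g}) + card {g<..length w + t + s}" .
    have "h \<in> gaps21 R w" if "g < h" "h \<le> length w" for h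
      by (subst gaps21_eq) (use False that in simp)
    moreover have "h \<le> length w" if "h \<in> gaps21 R w" for h
      using that by (simp add: gaps21_def)
    ultimately have "gaps21 R w = (gaps21 R w \<inter> {..g}) \<union> {g<..length w}"
      by (auto simp: not_le)
    then have "card (gaps21 R w) = card ((gaps21 R w \<inter> {..g}) \<union> {g<..length w})" by metis
    also have "\<dots> = card (gaps21 R w \<inter> {..g}) + card {g<..length w}"
      by (rule card_Un_disjoint) auto
    finally show ?thesis using 1 False g by simp
  qed
qed

end

section \<open>Equal distribution of the gap statistics\<close>

text \<open>The summand depends only on the rank of \<open>g\<close> in \<open>X\<close>, and each
  rank occurs once. Adding a new maximum leaves the earlier ranks unchanged.\<close>

lemma sum_rank:
  fixes f :: "nat \<Rightarrow> nat" and X :: "nat set"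
  assumes "finite X"
  shows "(\<Sum>g\<in>X. f (card (X \<inter> {..g}))) = (\<Sum>r=1..card X. f r)"
  using assms
proof (induction X rule: finite_linorder_max_induct)
  case empty
  then show ?case by simp
next
  case (insert b A)
  have b: "b \<notin> A" using insert.hyps(2) by blast
  have "insert b A \<inter> {..g} = A \<inter> {..g}" if "g \<in> A" for g
    using insert.hyps(2) that by force
  moreover have "insert b A \<inter> {..b} = insert b A"
    using insert.hyps(2) by force
  ultimately show ?case
    using insert.hyps(1) insert.IH b by simp
qed

text \<open>The counterpart with ranks counted from above; in an interval the rank of
  \<open>g\<close> is \<open>m - g\<close>, so reflection reindexes the sum.\<close>

lemma sum_corank:
  fixes f :: "nat \<Rightarrow> nat" and X :: "nat set"
  assumes "X = {l..<m}"
  shows "(\<Sum>g\<in>X. f (card (X \<inter> {g..}))) = (\<Sum>r=1..card X. f r)"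
proof -
  have "X \<inter> {g..} = {g..<m}" if "g \<in> X" for g using assms that by auto
  then have "(\<Sum>g\<in>X. f (card (X \<inter> {g..}))) = (\<Sum>g\<in>{l..<m}. f (m - g))"
    using assms by (auto intro!: sum.cong)
  also have "\<dots> = (\<Sum>r\<in>{1..m-l}. f r)"
    by (rule sum.reindex_bij_witness[of _ "\<lambda>r. m - r" "\<lambda>g. m - g"]) auto
  finally show ?thesis using assms by simp
qed

text \<open>All copies of the minimum are removed at once, because \<open>insert_copies\<close>
  places them together.\<close>

lemma mset_min_induct [case_names empty add]:
  fixes S :: "nat multiset"
  assumes "P {#}"
    and step: "\<And>S x a. P S \<Longrightarrow> (\<And>y. y \<in># S \<Longrightarrow> x < y) \<Longrightarrow> a \<ge> 1 \<Longrightarrow> P (S + replicate_mset a x)"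
  shows "P S"
proof (induction "size S" arbitrary: S rule: less_induct)
  case less
  show ?case
  proof (cases "S = {#}")
    case True
    then show ?thesis using assms(1) by simp
  next
    case False
    define x where "x = Min (set_mset S)"
    define S' where "S' = filter_mset (\<lambda>y. y \<noteq> x) S"
    have x: "x \<in># S" "\<And>y. y \<in># S \<Longrightarrow> x \<le> y" using False by (auto simp: x_def)
    have S: "S = S' + replicate_mset (count S x) x"
      by (rule multiset_eqI) (auto simp: S'_def)
    have "size S = size S' + count S x"
      using arg_cong[OF S, of size] by simp
    moreover have "count S x \<ge> 1" using x(1) by (simp add: Suc_le_eq)
    ultimately have "P S'" using less by simp
    moreover have "x < y" if "y \<in># S'" for y
      using that x(2)[of y] by (auto simp: S'_def)
    ultimately have "P (S' + replicate_mset (count S x) x)"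
      using \<open>count S x \<ge> 1\<close> by (intro step) auto
    then show ?thesis using S by simp
  qed
qed

section \<open>The two word classes and the recursion for the pair of gap count and
  \<open>tau_end\<close>\<close>

definition words12 :: "(nat \<Rightarrow> nat \<Rightarrow> bool) \<Rightarrow> (nat list \<Rightarrow> bool) \<Rightarrow> nat multiset \<Rightarrow> nat list set" where
  "words12 R C S = {w \<in> permutations_of_multiset S. C w \<and> \<not> contains_12_tau R w}"

definition words21 :: "(nat \<Rightarrow> nat \<Rightarrow> bool) \<Rightarrow> (nat list \<Rightarrow> bool) \<Rightarrow> nat multiset \<Rightarrow> nat list set" where
  "words21 R C S = {w \<in> permutations_of_multiset S. C w \<and> \<not> contains_21_tau R w}"

lemma length_takeWhile_insert_copies:
  assumes "x \<notin> set w" "g \<le> length w" "t \<ge> 1"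
  shows "length (takeWhile (\<lambda>y. y \<noteq> x) (insert_copies x t s g w)) = g"
proof -
  obtain k where k: "t = Suc k" using assms(3) by (cases t) auto
  have "\<forall>y\<in>set (take g w). y \<noteq> x" using assms(1) by (auto dest: in_set_takeD)
  then show ?thesis using assms(2)
    by (simp add: insert_copies_def k takeWhile_append2)
qed

text \<open>Erasing \<open>x\<close> recovers \<open>w\<close>, and the number of letters before the
  first \<open>x\<close> recovers \<open>g\<close>.\<close>

lemma inj_on_insert_copies:
  assumes t: "t \<ge> 1" and w: "\<And>w. w \<in> A \<Longrightarrow> x \<notin> set w" and G: "\<And>w g. w \<in> A \<Longrightarrow> g \<in> G w \<Longrightarrow> g \<le> length w"
  shows "inj_on (\<lambda>(w, g). insert_copies x t s g w) (Sigma A G)"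
proof (rule inj_onI, clarsimp)
  fix w g v h
  assume *: "w \<in> A" "g \<in> G w" "v \<in> A" "h \<in> G v" "insert_copies x t s g w = insert_copies x t s h v"
  have f: "filter (\<lambda>y. y \<noteq> x) (insert_copies x t s g w) = w" if "x \<notin> set w" for g w
  proof -
    have "filter (\<lambda>y. y \<noteq> x) (take g w) = take g w" "filter (\<lambda>y. y \<noteq> x) (drop g w) = drop g w"
      using that by (auto simp: filter_id_conv dest: in_set_takeD in_set_dropD)
    then show ?thesis by (simp add: insert_copies_def)
  qed
  have "w = v" using f[OF w[OF *(1)]] f[OF w[OF *(3)]] *(5) by metis
  moreover have "g = h"
    using length_takeWhile_insert_copies[OF w[OF *(1)] G[OF *(1,2)] t]
      length_takeWhile_insert_copies[OF w[OF *(3)] G[OF *(3,4)] t] *(5) by metis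
  ultimately show "w = v \<and> g = h" ..
qed

text \<open>\<open>U\<close> and \<open>V\<close> give the new value of \<open>tau_end\<close>. It matters that \<open>U\<close> does not depend on the gap: left
  of \<open>tau_end\<close> the admissible gaps of the two pattern classes are different, and only their number
    agrees.\<close>

locale insertion_class =
  fixes R :: "nat \<Rightarrow> nat \<Rightarrow> bool" and C :: "nat list \<Rightarrow> bool"
    and t s :: "nat \<Rightarrow> nat" and U :: "nat \<Rightarrow> nat \<Rightarrow> nat \<Rightarrow> nat" and V :: "nat \<Rightarrow> nat \<Rightarrow> nat \<Rightarrow> nat \<Rightarrow> nat"
  assumes t_pos: "\<And>a. a \<ge> 1 \<Longrightarrow> t a \<ge> 1"
    and class_insert: "\<And>S x a. a \<ge> 1 \<Longrightarrow> (\<And>y. y \<in># S \<Longrightarrow> x < y) \<Longrightarrow>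
      {w \<in> permutations_of_multiset (S + replicate_mset a x). C w}
      = {insert_copies x (t a) (s a) g w | g w. w \<in> permutations_of_multiset S \<and> C w \<and> g \<le> length w}"
    and tau_end_insert: "\<And>w x a g. a \<ge> 1 \<Longrightarrow> (\<And>y. y \<in> set w \<Longrightarrow> x < y) \<Longrightarrow> g \<le> length w \<Longrightarrow>
      tau_end R (insert_copies x (t a) (s a) g w) =
        (if g < tau_end R w then U (length w) a (tau_end R w) else V (length w) a (tau_end R w) g)"
begin

text \<open>The total contribution of all insertions into one word of length \<open>n\<close> with
  \<open>c\<close> admissible gaps and \<open>tau_end\<close> equal to \<open>T\<close>. In the
  first sum \<open>r\<close> counts the surviving gaps left of \<open>T\<close>; the second sum runs
  over the gaps from \<open>T\<close> on, where none is lost.\<close>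

definition step :: "(nat \<Rightarrow> nat \<Rightarrow> nat) \<Rightarrow> nat \<Rightarrow> nat \<Rightarrow> nat \<Rightarrow> nat \<Rightarrow> nat" where
  "step F n a c T =
     (\<Sum>r=1..c - (n + 1 - T). F (n + s a + 1 - T + r) (U n a T)) +
     (\<Sum>g=T..n. F (c + t a + s a) (V n a T g))"

context
  fixes S :: "nat multiset" and x a :: nat
  assumes min: "\<And>y. y \<in># S \<Longrightarrow> x < y" and a: "a \<ge> 1"
begin

lemma word_min: "w \<in> permutations_of_multiset S \<Longrightarrow> y \<in> set w \<Longrightarrow> x < y"
  using min by (auto dest: permutations_of_multisetD)

lemma class_eq:
  "{w \<in> permutations_of_multiset (S + replicate_mset a x). C w}
    = {insert_copies x (t a) (s a) g w | g w. w \<in> permutations_of_multiset S \<and> C w \<and> g \<le> length w}"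
  using a min by (rule class_insert)

lemma words12_insert:
  "words12 R C (S + replicate_mset a x)
    = (\<lambda>(w, g). insert_copies x (t a) (s a) g w) ` Sigma (words12 R C S) (gaps12 R)"
proof -
  have "words12 R C (S + replicate_mset a x) =
    {v \<in> {w \<in> permutations_of_multiset (S + replicate_mset a x). C w}. \<not> contains_12_tau R v}"
    by (auto simp: words12_def)
  also have "\<dots> = {v. \<exists>g w. v = insert_copies x (t a) (s a) g w \<and> w \<in> permutations_of_multiset S \<and>
    C w \<and> g \<le> length w \<and> \<not> contains_12_tau R v}"
    unfolding class_eq by auto
  also have "\<dots> = {v. \<exists>g w. v = insert_copies x (t a) (s a) g w \<and> w \<in> permutations_of_multiset S \<and>
    C w \<and> g \<le> length w \<and> \<not> contains_12_tau R w \<and> \<not> one_tau R (drop g w)}"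
    using contains_12_tau_insert[OF word_min _ t_pos[OF a]] by (intro Collect_cong ex_cong1) auto
  also have "\<dots> = (\<lambda>(w, g). insert_copies x (t a) (s a) g w) ` Sigma (words12 R C S) (gaps12 R)"
    by (auto simp: words12_def gaps12_def image_iff) blast
  finally show ?thesis .
qed

lemma words21_insert:
  "words21 R C (S + replicate_mset a x)
    = (\<lambda>(w, g). insert_copies x (t a) (s a) g w) ` Sigma (words21 R C S) (gaps21 R)"
proof -
  have "words21 R C (S + replicate_mset a x) =
    {v \<in> {w \<in> permutations_of_multiset (S + replicate_mset a x). C w}. \<not> contains_21_tau R v}"
    by (auto simp: words21_def)
  also have "\<dots> = {v. \<exists>g w. v = insert_copies x (t a) (s a) g w \<and> w \<in> permutations_of_multiset S \<and>
    C w \<and> g \<le> length w \<and> \<not> contains_21_tau R v}"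
    unfolding class_eq by auto
  also have "\<dots> = {v. \<exists>g w. v = insert_copies x (t a) (s a) g w \<and> w \<in> permutations_of_multiset S \<and>
    C w \<and> g \<le> length w \<and> \<not> contains_21_tau R w \<and> \<not> (\<exists>j\<in>set (take g w). tau_above R j (drop g w))}"
    using contains_21_tau_insert[OF word_min _ t_pos[OF a]] by (intro Collect_cong ex_cong1) auto
  also have "\<dots> = (\<lambda>(w, g). insert_copies x (t a) (s a) g w) ` Sigma (words21 R C S) (gaps21 R)"
    by (auto simp: words21_def gaps21_def image_iff) blast
  finally show ?thesis .
qed

text \<open>Left of \<open>tau_end\<close> the survivors are the gaps from \<open>g\<close> upwards,
  so ranks are counted from above.\<close>

lemma sum_gaps12:
  assumes w: "w \<in> permutations_of_multiset S"
  shows "(\<Sum>g\<in>gaps12 R w. F (card (gaps12 R (insert_copies x (t a) (s a) g w))) (tau_end R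
    (insert_copies x (t a) (s a) g w)))
    = step F (size S) a (card (gaps12 R w)) (tau_end R w)"
proof -
  let ?T = "tau_end R w" and ?n = "length w" and ?G = "gaps12 R w"
  \<comment> \<open>All words over \<open>S\<close> have this length, so one function
    \<open>step F (size S) a\<close> serves all of them.\<close>
  have n: "?n = size S" using w by (metis permutations_of_multisetD size_mset)
  let ?X = "{one_tau_end R w..<?T}"
  have G: "?G = ?X \<union> {?T..?n}" "finite ?G"
    using one_tau_end_le_tau_end[of R w] tau_end_le[of R w] by (auto simp: gaps12_eq)
  have cX: "card ?X = card ?G - (?n + 1 - ?T)"
    using one_tau_end_le_tau_end[of R w] tau_end_le[of R w] by (simp add: gaps12_eq)
  have "(\<Sum>g\<in>?G. F (card (gaps12 R (insert_copies x (t a) (s a) g w))) (tau_end R (insert_copies x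
    (t a) (s a) g w)))
    = (\<Sum>g\<in>?G. if g < ?T then F (?n + s a + 1 - ?T + card (?G \<inter> {g..<?T})) (U ?n a ?T)
         else F (card ?G + t a + s a) (V ?n a ?T g))"
  proof (rule sum.cong[OF refl])
    fix g assume g: "g \<in> ?G"
    then have "g \<le> ?n" by (simp add: gaps12_def)
    then show "F (card (gaps12 R (insert_copies x (t a) (s a) g w))) (tau_end R (insert_copies x
      (t a) (s a) g w)) =
      (if g < ?T then F (?n + s a + 1 - ?T + card (?G \<inter> {g..<?T})) (U ?n a ?T)
         else F (card ?G + t a + s a) (V ?n a ?T g))"
      using gaps12_insert[OF word_min[OF w] _ t_pos[OF a] g]
        tau_end_insert[OF a word_min[OF w]] by simp
  qed
  also have "\<dots> = (\<Sum>g\<in>?X. F (?n + s a + 1 - ?T + card (?G \<inter> {g..<?T})) (U ?n a ?T))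
    + (\<Sum>g=?T..?n. F (card ?G + t a + s a) (V ?n a ?T g))"
    unfolding G(1) by (subst sum.union_disjoint) (auto intro!: arg_cong2[of _ _ _ _ "(+)"] sum.cong)
  also have "(\<Sum>g\<in>?X. F (?n + s a + 1 - ?T + card (?G \<inter> {g..<?T})) (U ?n a ?T))
    = (\<Sum>g\<in>?X. F (?n + s a + 1 - ?T + card (?X \<inter> {g..})) (U ?n a ?T))"
  proof (rule sum.cong[OF refl])
    fix g
    have "?G \<inter> {g..<?T} = ?X \<inter> {g..}" using G(1) by auto
    then show "F (?n + s a + 1 - ?T + card (?G \<inter> {g..<?T})) (U ?n a ?T)
      = F (?n + s a + 1 - ?T + card (?X \<inter> {g..})) (U ?n a ?T)"
      by simp
  qed
  also have "\<dots> = (\<Sum>r=1..card ?X. F (?n + s a + 1 - ?T + r) (U ?n a ?T))"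
    by (rule sum_corank[where f = "\<lambda>r. F (?n + s a + 1 - ?T + r) (U ?n a ?T)"]) (rule refl)
  finally show ?thesis unfolding step_def n cX .
qed

text \<open>Here the survivors are the gaps up to \<open>g\<close>, possibly with holes; ranks
  counted from below give the same sum.\<close>

lemma sum_gaps21:
  assumes w: "w \<in> permutations_of_multiset S"
  shows "(\<Sum>g\<in>gaps21 R w. F (card (gaps21 R (insert_copies x (t a) (s a) g w))) (tau_end R
    (insert_copies x (t a) (s a) g w)))
    = step F (size S) a (card (gaps21 R w)) (tau_end R w)"
proof -
  let ?T = "tau_end R w" and ?n = "length w" and ?G = "gaps21 R w"
  have n: "?n = size S" using w by (metis permutations_of_multisetD size_mset)
  let ?X = "?G \<inter> {..<?T}"
  have G: "?G = ?X \<union> {?T..?n}" by (rule gaps21_eq)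
  have cX: "card ?X = card ?G - (?n + 1 - ?T)"
    using card_gaps21[of R w] by simp
  let ?f = "\<lambda>g. if g < ?T then F (?n + s a + 1 - ?T + card (?G \<inter> {..g})) (U ?n a ?T)
         else F (card ?G + t a + s a) (V ?n a ?T g)"
  have "(\<Sum>g\<in>?G. F (card (gaps21 R (insert_copies x (t a) (s a) g w))) (tau_end R (insert_copies x
    (t a) (s a) g w)))
    = (\<Sum>g\<in>?G. ?f g)"
  proof (rule sum.cong[OF refl])
    fix g assume g: "g \<in> ?G"
    then have "g \<le> ?n" by (simp add: gaps21_def)
    then show "F (card (gaps21 R (insert_copies x (t a) (s a) g w))) (tau_end R (insert_copies x
      (t a) (s a) g w)) = ?f g"
      using gaps21_insert[OF word_min[OF w] _ t_pos[OF a] g]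
        tau_end_insert[OF a word_min[OF w]] by simp
  qed
  also have "\<dots> = (\<Sum>g\<in>?X \<union> {?T..?n}. ?f g)" using G by (rule sum.cong) (rule refl)
  also have "\<dots> = (\<Sum>g\<in>?X. ?f g) + (\<Sum>g=?T..?n. ?f g)"
    by (rule sum.union_disjoint) auto
  also have "(\<Sum>g=?T..?n. ?f g) = (\<Sum>g=?T..?n. F (card ?G + t a + s a) (V ?n a ?T g))"
    by (rule sum.cong) auto
  also have "(\<Sum>g\<in>?X. ?f g) = (\<Sum>g\<in>?X. F (?n + s a + 1 - ?T + card (?X \<inter> {..g})) (U ?n a ?T))"
  proof (rule sum.cong[OF refl])
    fix g assume "g \<in> ?X"
    then have "?G \<inter> {..g} = ?X \<inter> {..g}" "g < ?T" by auto
    then show "?f g = F (?n + s a + 1 - ?T + card (?X \<inter> {..g})) (U ?n a ?T)"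
      by simp
  qed
  also have "\<dots> = (\<Sum>r=1..card ?X. F (?n + s a + 1 - ?T + r) (U ?n a ?T))"
    by (rule sum_rank[where f = "\<lambda>r. F (?n + s a + 1 - ?T + r) (U ?n a ?T)"]) simp
  finally show ?thesis unfolding step_def n cX .
qed

text \<open>Each new word arises from exactly one pair of an old word and an admissible gap, so the
  sum becomes a double sum with inner sum \<open>sum_gaps12\<close>.\<close>

lemma sum_words12:
  "(\<Sum>v\<in>words12 R C (S + replicate_mset a x). F (card (gaps12 R v)) (tau_end R v))
    = (\<Sum>w\<in>words12 R C S. step F (size S) a (card (gaps12 R w)) (tau_end R w))"
proof -
  have inj: "inj_on (\<lambda>(w, g). insert_copies x (t a) (s a) g w) (Sigma (words12 R C S) (gaps12 R))"
    using word_min by (intro inj_on_insert_copies t_pos a) (fastforce simp: words12_def gaps12_def)+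
  have fin: "finite (words12 R C S)" "\<forall>w\<in>words12 R C S. finite (gaps12 R w)"
    by (auto simp: words12_def gaps12_def)
  show ?thesis
    unfolding words12_insert sum.reindex[OF inj]
    using sum.Sigma[OF fin, of "\<lambda>w g. F (card (gaps12 R (insert_copies x (t a) (s a) g w)))
      (tau_end R (insert_copies x (t a) (s a) g w))"]
    by (simp add: case_prod_unfold o_def sum_gaps12 words12_def)
qed

lemma sum_words21:
  "(\<Sum>v\<in>words21 R C (S + replicate_mset a x). F (card (gaps21 R v)) (tau_end R v))
    = (\<Sum>w\<in>words21 R C S. step F (size S) a (card (gaps21 R w)) (tau_end R w))"
proof -
  have inj: "inj_on (\<lambda>(w, g). insert_copies x (t a) (s a) g w) (Sigma (words21 R C S) (gaps21 R))"
    using word_min by (intro inj_on_insert_copies t_pos a) (fastforce simp: words21_def gaps21_def)+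
  have fin: "finite (words21 R C S)" "\<forall>w\<in>words21 R C S. finite (gaps21 R w)"
    by (auto simp: words21_def gaps21_def)
  show ?thesis
    unfolding words21_insert sum.reindex[OF inj]
    using sum.Sigma[OF fin, of "\<lambda>w g. F (card (gaps21 R (insert_copies x (t a) (s a) g w)))
      (tau_end R (insert_copies x (t a) (s a) g w))"]
    by (simp add: case_prod_unfold o_def sum_gaps21 words21_def)
qed

end

text \<open>An arbitrary weight \<open>F\<close> expresses equality of the joint distributions. The
  induction closes because \<open>step F (size S) a\<close> is again such a weight.\<close>

lemma sum_words12_eq_sum_words21:
  fixes F :: "nat \<Rightarrow> nat \<Rightarrow> nat"
  shows
  "(\<Sum>w\<in>words12 R C S. F (card (gaps12 R w)) (tau_end R w))
    = (\<Sum>w\<in>words21 R C S. F (card (gaps21 R w)) (tau_end R w))"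
proof (induction S arbitrary: F rule: mset_min_induct)
  case empty
  have "words12 R C {#} = words21 R C {#}"
    by (auto simp: words12_def words21_def contains_12_tau_def contains_21_tau_def)
  moreover have "gaps12 R [] = gaps21 R []" by (auto simp: gaps12_def gaps21_def one_tau_def)
  moreover have "w = []" if "w \<in> words21 R C {#}" for w
    using that by (simp add: words21_def)
  ultimately show ?case by (intro sum.cong) (simp, metis)
next
  case (add S x a)
  have "(\<Sum>v\<in>words12 R C (S + replicate_mset a x). F (card (gaps12 R v)) (tau_end R v))
    = (\<Sum>w\<in>words12 R C S. step F (size S) a (card (gaps12 R w)) (tau_end R w))"
    using add(2,3) by (rule sum_words12)
  also have "\<dots> = (\<Sum>w\<in>words21 R C S. step F (size S) a (card (gaps21 R w)) (tau_end R w))"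
    by (rule add(1))
  also have "\<dots> = (\<Sum>v\<in>words21 R C (S + replicate_mset a x). F (card (gaps21 R v)) (tau_end R v))"
    using add(2,3) by (rule sum_words21[symmetric])
  finally show ?case .
qed

lemma card_words12_eq_card_words21: "card (words12 R C S) = card (words21 R C S)"
  using sum_words12_eq_sum_words21[where F = "\<lambda>_ _. 1"] by simp

end

section \<open>Words avoiding 121 or 112\<close>

lemma mset_insert_copies: "mset (insert_copies x t s g w) = mset w + replicate_mset (t + s) x"
proof -
  have "mset (insert_copies x t s g w) = mset (take g w @ drop g w) + replicate_mset t x
    + replicate_mset s x"
    unfolding insert_copies_def mset_append by simp
  moreover have "replicate_mset (t + s) x = replicate_mset t x + replicate_mset s x"
    by (rule multiset_eqI) simp
  ultimately show ?thesis by simp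
qed

lemma permutation_insert_copies_iff:
  assumes "x \<notin># S" "x \<notin> set w"
  shows "insert_copies x t s g w \<in> permutations_of_multiset (S + replicate_mset a x)
    \<longleftrightarrow> t + s = a \<and> w \<in> permutations_of_multiset S"
proof -
  have "count S x = 0" "count (mset w) x = 0"
    using assms by (simp_all add: count_eq_zero_iff)
  then have "t + s = a" if "mset w + replicate_mset (t + s) x = S + replicate_mset a x"
    using arg_cong[OF that, of "\<lambda>M. count M x"]
      by (simp only: count_union count_replicate_mset refl if_True add_0)
  then show ?thesis by (auto simp: permutations_of_multiset_def mset_insert_copies)
qed

text \<open>Applied to the part behind the first \<open>x\<close> of a word avoiding 121.\<close>

lemma all_min_first:
  assumes "\<And>y. y \<noteq> x \<Longrightarrow> \<not> subseq [y,x] v"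
  shows "\<exists>k q. v = replicate k x @ q \<and> x \<notin> set q"
  using assms
proof (induction v)
  case Nil
  show ?case by (intro exI[of _ 0]) simp
next
  case (Cons z v)
  have "\<not> subseq [y,x] v" if "y \<noteq> x" for y using Cons.prems[OF that] by (blast intro: list_emb_Cons)
  then obtain k q where v: "v = replicate k x @ q" "x \<notin> set q" using Cons.IH by blast
  show ?case
  proof (cases "z = x")
    case True
    then show ?thesis using v by (intro exI[of _ "Suc k"] exI[of _ q]) simp
  next
    case False
    then have "x \<notin> set v" using Cons.prems[OF False] by (simp add: subseq_singleton_left)
    then show ?thesis using False by (intro exI[of _ 0] exI[of _ "z # v"]) simp
  qed
qed

text \<open>Applied to the part behind the first \<open>x\<close> of a word avoiding 112.\<close>

lemma all_min_last:
  assumes "\<And>y. y \<noteq> x \<Longrightarrow> \<not> subseq [x,y] v"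
  shows "\<exists>k q. v = q @ replicate k x \<and> x \<notin> set q"
  using assms
proof (induction v)
  case Nil
  show ?case by (intro exI[of _ 0]) simp
next
  case (Cons z v)
  have "\<not> subseq [x,y] v" if "y \<noteq> x" for y using Cons.prems[OF that] by (blast intro: list_emb_Cons)
  then obtain k q where v: "v = q @ replicate k x" "x \<notin> set q" using Cons.IH by blast
  show ?case
  proof (cases "z = x")
    case True
    have "y = x" if "y \<in> set v" for y
      using Cons.prems[of y] True that by (auto simp: subseq_singleton_left)
    then have "v = replicate (length v) x" by (simp add: replicate_length_same)
    then show ?thesis using True by (intro exI[of _ "Suc (length v)"] exI[of _ "[]"]) simp
  next
    case False
    then show ?thesis using v by (intro exI[of _ k] exI[of _ "z # q"]) simp
  qed
qed

definition avoids121 :: "nat list \<Rightarrow> bool" where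
  "avoids121 w \<longleftrightarrow> \<not> (\<exists>i j. i < j \<and> subseq [i,j,i] w)"

definition avoids112 :: "nat list \<Rightarrow> bool" where
  "avoids112 w \<longleftrightarrow> \<not> (\<exists>i j. i < j \<and> subseq [i,i,j] w)"

lemma split_insert_copies:
  assumes "v = p @ replicate t x @ q @ replicate s x"
  shows "v = insert_copies x t s (length p) (p @ q)"
  using assms by (simp add: insert_copies_def)

lemma subseq_insert_copies_self: "subseq w (insert_copies x t s g w)"
proof -
  have "subseq (take g w @ [] @ drop g w @ []) (take g w @ replicate t x @ drop g w @ replicate s x)"
    by (intro list_emb_append_mono) auto
  then show ?thesis by (simp add: insert_copies_def)
qed

lemma avoids121_subseq:
  assumes "avoids121 v" "subseq w v"
  shows "avoids121 w"
proof -
  have "subseq [i,j,i] v" if "subseq [i,j,i] w" for i j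
    using that assms(2) by (rule subseq_order.order_trans)
  then show ?thesis using assms(1) unfolding avoids121_def by auto
qed

lemma avoids112_subseq:
  assumes "avoids112 v" "subseq w v"
  shows "avoids112 w"
proof -
  have "subseq [i,i,j] v" if "subseq [i,i,j] w" for i j
    using that assms(2) by (rule subseq_order.order_trans)
  then show ?thesis using assms(1) unfolding avoids112_def by auto
qed

text \<open>With \<open>s = 0\<close> the copies are adjacent, so nothing stands between two of
  them. An occurrence whose repeated letter exceeds \<open>x\<close> uses no copy and lies in
  \<open>w\<close>.\<close>

lemma avoids121_insert_copies:
  assumes min: "\<And>y. y \<in> set w \<Longrightarrow> x < y"
  shows "avoids121 (insert_copies x t 0 g w) \<longleftrightarrow> avoids121 w"
proof
  assume "avoids121 (insert_copies x t 0 g w)"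
  then show "avoids121 w" using avoids121_subseq subseq_insert_copies_self by metis
next
  assume av: "avoids121 w"
  have "False" if ij: "i < j" "subseq [i,j,i] (insert_copies x t 0 g w)" for i j
  proof (cases "i = x")
    case False
    have "i \<in> set (insert_copies x t 0 g w)" using subseq_set[OF ij(2)] by simp
    then have "x < i" using False min by (auto simp: insert_copies_def dest: in_set_takeD in_set_dropD)
    then have "subseq [i,j,i] w"
      using ij subseq_insert_copies[of w x "[i,j,i]"] min by auto
    then show False using av ij(1) unfolding avoids121_def by auto
  next
    case True
    have x: "x \<notin> set (take g w)" "x \<notin> set (drop g w)"
      using min by (blast dest: in_set_takeD in_set_dropD)+
    have "subseq [x,j,x] (replicate t x @ drop g w)"
      using ij True subseq_Cons_skip[OF x(1)] by (simp add: insert_copies_def)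
    then have "subseq [j,x] (replicate t x @ drop g w)" by (rule subseq_Cons')
    then have "subseq [j,x] (drop g w)"
      using subseq_Cons_skip[of j "replicate t x"] ij True by simp
    then show False using subseq_set[of "[j,x]" "drop g w"] x by auto
  qed
  then show "avoids121 (insert_copies x t 0 g w)" unfolding avoids121_def by blast
qed

text \<open>All copies but the first stand behind \<open>w\<close>, so no larger letter follows two
  of them.\<close>

lemma avoids112_insert_copies:
  assumes min: "\<And>y. y \<in> set w \<Longrightarrow> x < y"
  shows "avoids112 (insert_copies x 1 s g w) \<longleftrightarrow> avoids112 w"
proof
  assume "avoids112 (insert_copies x 1 s g w)"
  then show "avoids112 w" using avoids112_subseq subseq_insert_copies_self by metis
next
  assume av: "avoids112 w"
  have "False" if ij: "i < j" "subseq [i,i,j] (insert_copies x 1 s g w)" for i j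
  proof (cases "i = x")
    case False
    have "i \<in> set (insert_copies x 1 s g w)" using subseq_set[OF ij(2)] by simp
    then have "x < i" using False min by (auto simp: insert_copies_def dest: in_set_takeD in_set_dropD)
    then have "subseq [i,i,j] w"
      using ij subseq_insert_copies[of w x "[i,i,j]"] min by auto
    then show False using av ij(1) unfolding avoids112_def by auto
  next
    case True
    have x: "x \<notin> set (take g w)" "x \<notin> set (drop g w)"
      using min by (blast dest: in_set_takeD in_set_dropD)+
    have "subseq [x,x,j] (x # drop g w @ replicate s x)"
      using ij True subseq_Cons_skip[OF x(1)] by (simp add: insert_copies_def)
    then have "subseq [x,j] (drop g w @ replicate s x)" by simp
    then have "subseq [x,j] (replicate s x)"
      using subseq_Cons_skip[OF x(2)] by simp
    then show False using subseq_set[of "[x,j]" "replicate s x"] ij True by auto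
  qed
  then show "avoids112 (insert_copies x 1 s g w)" unfolding avoids112_def by blast
qed

lemma set_permutation: "w \<in> permutations_of_multiset M \<Longrightarrow> set w = set_mset M"
  by (metis permutations_of_multisetD set_mset_mset)

lemma permutation_split_first:
  assumes "v \<in> permutations_of_multiset (S + replicate_mset a x)" "a \<ge> 1"
  obtains p u where "v = p @ x # u" "x \<notin> set p"
proof -
  have "x \<in> set v"
    using set_permutation[OF assms(1)] assms(2) by simp
  then show ?thesis using that split_list_first by metis
qed

text \<open>Behind the first \<open>x\<close>, a larger letter followed by \<open>x\<close> would
  complete 121. Hence the other copies follow the first one immediately.\<close>

lemma avoids121_class_insert:
  assumes a: "a \<ge> 1" and min: "\<And>y. y \<in># S \<Longrightarrow> x < y"
  shows "{w \<in> permutations_of_multiset (S + replicate_mset a x). avoids121 w}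
    = {insert_copies x a 0 g w | g w. w \<in> permutations_of_multiset S \<and> avoids121 w \<and> g \<le> length w}"
    (is "?A = ?B")
proof (intro subset_antisym subsetI)
  have xS: "x \<notin># S" using min by blast
  have wmin: "x < y" if "w \<in> permutations_of_multiset S" "y \<in> set w" for w y
    using that set_permutation min by blast
  {
    fix v assume "v \<in> ?B"
    then obtain g w where v: "v = insert_copies x a 0 g w"
      and w: "w \<in> permutations_of_multiset S" "avoids121 w" by auto
    have "x \<notin> set w" using wmin[OF w(1), of x] by auto
    then have "v \<in> permutations_of_multiset (S + replicate_mset a x)"
      unfolding v using permutation_insert_copies_iff[OF xS] w(1) a by simp
    moreover have "avoids121 v"
      unfolding v using avoids121_insert_copies[of w x] wmin[OF w(1)] w(2) by simp
    ultimately show "v \<in> ?A" by simp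
  next
    fix v assume v: "v \<in> ?A"
    then have "v \<in> permutations_of_multiset (S + replicate_mset a x)" by simp
    then obtain p u where pu: "v = p @ x # u" "x \<notin> set p"
      using a by (rule permutation_split_first)
    have le: "x \<le> y" if "y \<in> set v" for y
      using set_permutation[of v] v that min[of y] a by auto
    have "\<not> subseq [y,x] u" if "y \<noteq> x" for y
    proof
      assume yx: "subseq [y,x] u"
      then have "y \<in> set v" using subseq_set[OF yx] pu by auto
      then have "x < y" using le that by (simp add: order_less_le)
      moreover have "subseq [x,y,x] v" using yx pu by (simp add: subseq_drop_many)
      ultimately show False using v unfolding avoids121_def by auto
    qed
    then obtain k q where q: "u = replicate k x @ q" "x \<notin> set q" using all_min_first by metis
    have vi: "v = insert_copies x (Suc k) 0 (length p) (p @ q)"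
      by (rule split_insert_copies) (simp add: pu q)
    \<comment> \<open>Comparing multiplicities of \<open>x\<close> identifies the block length with
      \<open>a\<close>.\<close>
    have pq: "Suc k + 0 = a \<and> p @ q \<in> permutations_of_multiset S"
      using v permutation_insert_copies_iff[OF xS, of "p @ q" "Suc k" 0 "length p" a] vi pu(2)
        q(2) by simp
    have "avoids121 v" using v by simp
    moreover have "avoids121 (insert_copies x (Suc k) 0 (length p) (p @ q)) \<longleftrightarrow> avoids121 (p @ q)"
      using wmin[OF conjunct2[OF pq]] by (rule avoids121_insert_copies)
    ultimately have "avoids121 (p @ q)" using vi by simp
    moreover have "v = insert_copies x a 0 (length p) (p @ q)" using vi pq by simp
    moreover have "length p \<le> length (p @ q)" by simp
    ultimately show "v \<in> ?B" using pq by blast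
  }
qed

text \<open>Behind the first \<open>x\<close>, another \<open>x\<close> followed by a larger letter
  would complete 112. Hence the other copies stand at the end.\<close>

lemma avoids112_class_insert:
  assumes a: "a \<ge> 1" and min: "\<And>y. y \<in># S \<Longrightarrow> x < y"
  shows "{w \<in> permutations_of_multiset (S + replicate_mset a x). avoids112 w}
    = {insert_copies x 1 (a - 1) g w | g w. w \<in> permutations_of_multiset S \<and> avoids112 w \<and> g \<le> length w}"
    (is "?A = ?B")
proof (intro subset_antisym subsetI)
  have xS: "x \<notin># S" using min by blast
  have wmin: "x < y" if "w \<in> permutations_of_multiset S" "y \<in> set w" for w y
    using that set_permutation min by blast
  {
    fix v assume "v \<in> ?B"
    then obtain g w where v: "v = insert_copies x 1 (a - 1) g w"
      and w: "w \<in> permutations_of_multiset S" "avoids112 w" by auto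
    have "x \<notin> set w" using wmin[OF w(1), of x] by auto
    then have "v \<in> permutations_of_multiset (S + replicate_mset a x)"
      unfolding v using permutation_insert_copies_iff[OF xS] w(1) a by simp
    moreover have "avoids112 v"
      unfolding v using avoids112_insert_copies[of w x] wmin[OF w(1)] w(2) by simp
    ultimately show "v \<in> ?A" by simp
  next
    fix v assume v: "v \<in> ?A"
    then have "v \<in> permutations_of_multiset (S + replicate_mset a x)" by simp
    then obtain p u where pu: "v = p @ x # u" "x \<notin> set p"
      using a by (rule permutation_split_first)
    have le: "x \<le> y" if "y \<in> set v" for y
      using set_permutation[of v] v that min[of y] a by auto
    have "\<not> subseq [x,y] u" if "y \<noteq> x" for y
    proof
      assume xy: "subseq [x,y] u"
      then have "y \<in> set v" using subseq_set[OF xy] pu by auto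
      then have "x < y" using le that by (simp add: order_less_le)
      moreover have "subseq [x,x,y] v" using xy pu by (simp add: subseq_drop_many)
      ultimately show False using v unfolding avoids112_def by auto
    qed
    then obtain k q where q: "u = q @ replicate k x" "x \<notin> set q" using all_min_last by metis
    have vi: "v = insert_copies x 1 k (length p) (p @ q)"
      by (rule split_insert_copies) (simp add: pu q)
    have pq: "1 + k = a \<and> p @ q \<in> permutations_of_multiset S"
      using v permutation_insert_copies_iff[OF xS, of "p @ q" 1 k "length p" a] vi pu(2) q(2) by simp
    have "avoids112 v" using v by simp
    moreover have "avoids112 (insert_copies x 1 k (length p) (p @ q)) \<longleftrightarrow> avoids112 (p @ q)"
      using wmin[OF conjunct2[OF pq]] by (rule avoids112_insert_copies)
    ultimately have "avoids112 (p @ q)" using vi by simp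
    moreover have "k = a - 1" using pq by auto
    moreover have "length p \<le> length (p @ q)" by simp
    ultimately show "v \<in> ?B" using vi pq by blast
  }
qed

section \<open>The value of \<open>tau_end\<close> after an insertion\<close>

lemma tau_appendI: "y \<in> set u \<Longrightarrow> z \<in> set v \<Longrightarrow> R y z \<Longrightarrow> tau R (u @ v)"
  unfolding tau_def using list_emb_append_mono[of "(=)" "[y]" u "[z]" v]
  by (auto simp: subseq_singleton_left)

lemma last_before_gap: "0 < g \<Longrightarrow> g \<le> length w \<Longrightarrow> drop (g - 1) (take g w) = [w ! (g - 1)]"
  by (cases g) (simp_all add: take_Suc_conv_app_nth)

text \<open>The minimum cannot be the top of a descent, so copies in front start none.\<close>

lemma not_tau_min_descent:
  assumes "\<not> tau (>) v" "\<And>y. y \<in> set v \<Longrightarrow> x < y"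
  shows "\<not> tau (>) (replicate k x @ v)"
proof
  assume "tau (>) (replicate k x @ v)"
  then obtain p q where pq: "q < p" "subseq [p,q] (replicate k x @ v)" unfolding tau_def by blast
  have "x \<le> q" using subseq_set[OF pq(2)] assms(2) by (auto intro: less_imp_le)
  then have "subseq [p,q] v" using pq subseq_Cons_skip[of p "replicate k x"] by simp
  then show False using assms(1) pq(1) unfolding tau_def by blast
qed

text \<open>The minimum cannot be the top of an ascent, so copies at the end complete none.\<close>

lemma not_tau_min_ascent:
  assumes "\<not> tau (<) v" "\<And>y. y \<in> set v \<Longrightarrow> x < y"
  shows "\<not> tau (<) (v @ replicate k x)"
proof
  assume "tau (<) (v @ replicate k x)"
  then obtain p q where pq: "p < q" "subseq [p,q] (v @ replicate k x)" unfolding tau_def by blast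
  have x: "x \<le> p" using subseq_set[OF pq(2)] assms(2) by (auto intro: less_imp_le)
  show False
  proof (cases "p = x")
    case True
    have "x \<notin> set v" using assms(2) by blast
    then have "subseq [x,q] (replicate k x)" using pq(2) True subseq_Cons_skip by metis
    then show False using subseq_set[of "[x,q]"] pq(1) True by fastforce
  next
    case False
    then have xpq: "x \<notin> set [p,q]" using x pq(1) by simp
    have "filter (\<lambda>y. y \<noteq> x) v = v" using assms(2) by (auto simp: filter_id_conv)
    then have "subseq [p,q] v"
      using pq(2) subseq_filter_iff[OF xpq, of "v @ replicate k x"] by simp
    then show False using assms(1) pq(1) unfolding tau_def by blast
  qed
qed

lemma tau_before_min:
  assumes "0 < g" "g \<le> length w" "R (w ! (g - 1)) x" "x \<in> set v"
  shows "tau R (drop (g - 1) (take g w) @ v)"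
  using assms last_before_gap[of g w] by (intro tau_appendI[where y = "w ! (g - 1)" and z = x]) auto

context
  fixes x :: nat and w :: "nat list" and g :: nat
  assumes min: "\<And>y. y \<in> set w \<Longrightarrow> x < y" and g: "g \<le> length w"
begin

lemma tau_end_insert_before:
  assumes "g < tau_end R w"
  shows "tau_end R (insert_copies x t 0 g w) = tau_end R w + t"
proof (rule tau_endI)
  show "\<not> tau R (drop (tau_end R w + t) (insert_copies x t 0 g w))"
    using assms g by (simp add: drop_insert_copies_ge tau_drop_iff)
  \<comment> \<open>Because \<open>g\<close> is at most \<open>tau_end R w - 1\<close>, even this
    longer suffix starts behind the block.\<close>
  have "drop (tau_end R w + t - 1) (insert_copies x t 0 g w) = drop (tau_end R w - 1) w"
    using assms g by (subst drop_insert_copies_ge) auto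
  then show "tau_end R w + t = 0 \<or> tau R (drop (tau_end R w + t - 1) (insert_copies x t 0 g w))"
    using assms by (simp add: tau_drop_iff)
qed

lemma drop_min: "y \<in> set (drop k w) \<Longrightarrow> x < y"
  using min by (blast dest: in_set_dropD)

text \<open>The last descent top is the letter just before the block: it exceeds \<open>x\<close>,
  while the suffix from the block on has no descent.\<close>

lemma tau_end_insert_descent:
  assumes "tau_end (>) w \<le> g" "t \<ge> 1"
  shows "tau_end (>) (insert_copies x t 0 g w) = g"
proof (rule tau_endI)
  have "\<not> tau (>) (drop g w)" using assms by (simp add: tau_drop_iff)
  then have "\<not> tau (>) (replicate t x @ drop g w)"
    using not_tau_min_descent drop_min by blast
  then show "\<not> tau (>) (drop g (insert_copies x t 0 g w))"
    using g by (simp add: drop_insert_copies_le)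
  show "g = 0 \<or> tau (>) (drop (g - 1) (insert_copies x t 0 g w))"
  proof (cases "g = 0")
    case False
    then have "w ! (g - 1) > x" using min g by simp
    then have "tau (>) (drop (g - 1) (take g w) @ replicate t x @ drop g w)"
      using False g assms(2) by (intro tau_before_min) auto
    then show ?thesis using g by (simp add: drop_insert_copies_le)
  qed simp
qed

text \<open>The last block copy forms an ascent with any letter of \<open>w\<close> behind it. If
  there is none, the copies end the word and create no ascent.\<close>

lemma tau_end_insert_ascent:
  assumes "tau_end (<) w \<le> g" "t \<ge> 1"
  shows "tau_end (<) (insert_copies x t 0 g w) = (if g < length w then g + t else tau_end (<) w)"
proof (cases "g < length w")
  case True
  have "tau_end (<) (insert_copies x t 0 g w) = g + t"
  proof (rule tau_endI)
    show "\<not> tau (<) (drop (g + t) (insert_copies x t 0 g w))"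
      using assms g by (simp add: drop_insert_copies_ge tau_drop_iff)
    have "drop (g + t - 1) (insert_copies x t 0 g w) = [x] @ drop g w"
      using assms g by (subst drop_insert_copies_mid) auto
    moreover have "w ! g \<in> set (drop g w)" using True by (simp flip: Cons_nth_drop_Suc)
    then have "tau (<) ([x] @ drop g w)"
      using drop_min by (intro tau_appendI[where y = x and z = "w ! g"]) auto
    ultimately show "g + t = 0 \<or> tau (<) (drop (g + t - 1) (insert_copies x t 0 g w))" by simp
  qed
  then show ?thesis using True by simp
next
  case False
  then have W: "insert_copies x t 0 g w = w @ replicate t x" using g by (simp add: insert_copies_def)
  have "tau_end (<) (w @ replicate t x) = tau_end (<) w"
  proof (rule tau_endI)
    have "\<not> tau (<) (drop (tau_end (<) w) w @ replicate t x)"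
      using drop_min by (intro not_tau_min_ascent) (auto simp: tau_drop_iff)
    then show "\<not> tau (<) (drop (tau_end (<) w) (w @ replicate t x))"
      using tau_end_le[of "(<)" w] by simp
    have "tau (<) (drop (tau_end (<) w - 1) w @ replicate t x)" if "tau_end (<) w \<noteq> 0"
    proof -
      have "tau (<) (drop (tau_end (<) w - 1) w)" using that by (simp add: tau_drop_iff)
      then show ?thesis unfolding tau_def by (blast intro: subseq_rev_drop_many)
    qed
    then show "tau_end (<) w = 0 \<or> tau (<) (drop (tau_end (<) w - 1) (w @ replicate t x))"
      using tau_end_le[of "(<)" w] by auto
  qed
  then show ?thesis using W False by simp
qed

text \<open>The last letter of a nonempty \<open>w\<close> forms a descent with a copy at the end,
  and only copies of \<open>x\<close> follow it. So \<open>tau_end\<close> is the gap right after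
  that letter, shifted by one if the first copy precedes it.\<close>

lemma tau_end_insert_split_descent:
  assumes "s \<ge> 1"
  shows "tau_end (>) (insert_copies x 1 s g w) = (if g < length w then length w + 1 else length w)"
proof -
  have nil: "\<not> tau (>) []" by (simp add: tau_def)
  have rep: "\<not> tau (>) (replicate k x)" for k using not_tau_min_descent[OF nil] by simp
  have last: "tau (>) (drop (length w - 1) w @ v)" if "w \<noteq> []" "x \<in> set v" for v
    using tau_before_min[where g = "length w" and w = w and x = x and R = "(>)" and v
      = v] min that by simp
  show ?thesis
  proof (cases "g < length w")
    case True
    have "tau_end (>) (insert_copies x 1 s g w) = length w + 1"
    proof (rule tau_endI)
      show "\<not> tau (>) (drop (length w + 1) (insert_copies x 1 s g w))"
        using g rep by (subst drop_insert_copies_ge) auto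
      \<comment> \<open>One copy of \<open>x\<close> comes earlier, so gap \<open>length w\<close>
        stands right before the last letter of \<open>w\<close>.\<close>
      have "drop (length w) (insert_copies x 1 s g w) = drop (length w - 1) w @ replicate s x"
        using g True by (subst drop_insert_copies_ge) auto
      moreover have "tau (>) (drop (length w - 1) w @ replicate s x)"
        using True assms by (intro last) auto
      ultimately show "length w + 1 = 0 \<or> tau (>) (drop (length w + 1 - 1) (insert_copies x 1 s g w))"
        by simp
    qed
    then show ?thesis using True by simp
  next
    case False
    then have W: "insert_copies x 1 s g w = w @ replicate (Suc s) x"
      using g by (simp add: insert_copies_def)
    have "tau_end (>) (w @ replicate (Suc s) x) = length w"
    proof (rule tau_endI)
      show "\<not> tau (>) (drop (length w) (w @ replicate (Suc s) x))" using rep[of "Suc s"] by simp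
      show "length w = 0 \<or> tau (>) (drop (length w - 1) (w @ replicate (Suc s) x))"
      proof (cases "w = []")
        case False
        then have "tau (>) (drop (length w - 1) w @ replicate (Suc s) x)"
          by (intro last) auto
        then show ?thesis by simp
      qed simp
    qed
    then show ?thesis using W False by simp
  qed
qed

end

section \<open>The three instances and the resulting equivalences\<close>

lemma avoids121_descent: 
  "insertion_class (>) avoids121 (\<lambda>a. a) (\<lambda>_. 0)
  (\<lambda>n a T. T + a) (\<lambda>n a T g. g)"
proof
  fix a x g :: nat and w
  assume *: "a \<ge> 1" "\<And>y. y \<in> set w \<Longrightarrow> x < y" "g \<le> length w"
  show "tau_end (>) (insert_copies x a 0 g w) = (if g < tau_end (>) w then tau_end (>) w + a else g)"
    using tau_end_insert_before[of w x g "(>)" a] tau_end_insert_descent[of w x g a] * by simp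
qed (simp_all add: avoids121_class_insert)

lemma avoids121_ascent: 
  "insertion_class (<) avoids121 (\<lambda>a. a) (\<lambda>_. 0)
  (\<lambda>n a T. T + a) (\<lambda>n a T g. if g < n then g + a else T)"
proof
  fix a x g :: nat and w
  assume *: "a \<ge> 1" "\<And>y. y \<in> set w \<Longrightarrow> x < y" "g \<le> length w"
  show "tau_end (<) (insert_copies x a 0 g w)
    = (if g < tau_end (<) w then tau_end (<) w + a else if g < length w then g + a else tau_end (<) w)"
    using tau_end_insert_before[of w x g "(<)" a] tau_end_insert_ascent[of w x g a] * by simp
qed (simp_all add: avoids121_class_insert)

text \<open>For \<open>a = 1\<close> no copy goes to the end and the computation is that of a single
  block; for larger \<open>a\<close> the copies at the end determine the value.\<close>

lemma avoids112_descent: 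
  "insertion_class (>) avoids112 (\<lambda>_. 1) (\<lambda>a. a - 1)
  (\<lambda>n a T. if a = 1 then T + 1 else n + 1) (\<lambda>n a T g. if a = 1 then g else if g < n then n + 1 else n)"
proof
  fix a x g :: nat and w
  assume *: "a \<ge> 1" "\<And>y. y \<in> set w \<Longrightarrow> x < y" "g \<le> length w"
  show "tau_end (>) (insert_copies x 1 (a - 1) g w)
    = (if g < tau_end (>) w then if a = 1 then tau_end (>) w + 1 else length w + 1
       else if a = 1 then g else if g < length w then length w + 1 else length w)"
  proof (cases "a = 1")
    case True
    then show ?thesis
      using tau_end_insert_before[of w x g "(>)" 1] tau_end_insert_descent[of w x g 1] * by simp
  next
    case False
    then have "tau_end (>) (insert_copies x 1 (a - 1) g w)
      = (if g < length w then length w + 1 else length w)"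
      using * by (intro tau_end_insert_split_descent) auto
    \<comment> \<open>A gap left of \<open>tau_end\<close> lies strictly before the end of
      \<open>w\<close>, which is why the value there is \<open>length w + 1\<close> regardless of
      \<open>g\<close>.\<close>
    then show ?thesis using False tau_end_le[of "(>)" w] by auto
  qed
qed (simp_all add: avoids112_class_insert[simplified])

lemma av_eq_card_words:
  assumes "\<And>w. contains w \<rho> \<longleftrightarrow> \<not> C w"
  shows "(\<And>w. contains w \<sigma> \<longleftrightarrow> contains_12_tau R w) \<Longrightarrow> av S {\<rho>, \<sigma>} = card (words12 R C S)"
    and "(\<And>w. contains w \<sigma> \<longleftrightarrow> contains_21_tau R w) \<Longrightarrow> av S {\<rho>, \<sigma>} = card (words21 R C S)"
  using assms by (simp_all add: av_def words12_def words21_def)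

lemma m_equivalent_insertion_class:
  assumes "insertion_class R C t s U V"
    and "\<And>w. contains w \<rho> \<longleftrightarrow> \<not> C w"
    and "\<And>w. contains w \<sigma> \<longleftrightarrow> contains_12_tau R w" "\<And>w. contains w \<sigma>' \<longleftrightarrow> contains_21_tau R w"
  shows "m_equivalent {\<rho>, \<sigma>} {\<rho>, \<sigma>'}"
proof -
  have "av S {\<rho>, \<sigma>} = av S {\<rho>, \<sigma>'}" for S
    using av_eq_card_words(1)[where C = C, OF assms(2,3)] av_eq_card_words(2)[where C = C, OF assms(2,4)]
      insertion_class.card_words12_eq_card_words21[OF assms(1)] by simp
  then show ?thesis unfolding m_equivalent_def by blast
qed

theorem theorem2p19:
  shows "m_equivalent {[1,2,1], [1,2,4,3]} {[1,2,1], [2,1,4,3]} \<and>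
         m_equivalent {[1,1,2], [1,2,4,3]} {[1,1,2], [2,1,4,3]} \<and>
         m_equivalent {[1,2,1], [1,2,3,4]} {[1,2,1], [2,1,3,4]}"
proof (intro conjI)
  have c121: "contains w [1,2,1] \<longleftrightarrow> \<not> avoids121 w" and c112: "contains w [1,1,2] \<longleftrightarrow> \<not> avoids112 w" for w
    unfolding contains_121 contains_112 avoids121_def avoids112_def by simp_all
  have c1243: "contains w [1,2,4,3] \<longleftrightarrow> contains_12_tau (>) w" and c2143: "contains w [2,1,4,3] \<longleftrightarrow>
    contains_21_tau (>) w"
    and c1234: "contains w [1,2,3,4] \<longleftrightarrow> contains_12_tau (<) w" and c2134: "contains w [2,1,3,4] \<longleftrightarrow>
      contains_21_tau (<) w" for w
    unfolding contains_1243 contains_2143 contains_1234 contains_2134 contains_12_tau_def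
      contains_21_tau_def by (rule refl)+
  show "m_equivalent {[1,2,1], [1,2,4,3]} {[1,2,1], [2,1,4,3]}"
    by (rule m_equivalent_insertion_class[OF avoids121_descent c121 c1243 c2143])
  show "m_equivalent {[1,1,2], [1,2,4,3]} {[1,1,2], [2,1,4,3]}"
    by (rule m_equivalent_insertion_class[OF avoids112_descent c112 c1243 c2143])
  show "m_equivalent {[1,2,1], [1,2,3,4]} {[1,2,1], [2,1,3,4]}"
    by (rule m_equivalent_insertion_class[OF avoids121_ascent c121 c1234 c2134])
qed

end
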